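(* Let $n\ge2$ and let $\xi$ be an $n\times n$ matrix with nonnegative entries and zero diagonal, with operator norm $\rho=\|\xi\|_{\mathrm{op}}$. Let $P_t$ and $Q_t$ be the Gaussian laws described in the context, and let $\overline H^k_T:=\binom nk^{-1}\sum_{v\subset[n],|v|=k}H(P^v_T\,|\,Q^v_T)$. Define $$D_T(\xi):=\sum_{i=1}^n\bigg(\sum_{m=2}^\infty\frac{T^m}{(m+1)!}(\xi^m)_{ii}\bigg)^2.$$ For $0<T\le\log(2)/(2\rho)$ (any $T>0$ if $\rho=0$) and $k\in[n]$, $$\overline H^k_T\asymp\frac{k(k-1)}{n(n-1)}\sum_{i,j=1}^n\xi_{ij}^2+\frac{k(n-k)}{n(n-1)}\bigg(D_T(\xi)+\sum_{i=1}^n\Big(\sum_{j=1}^n\xi_{ij}^2\Big)^2\bigg),$$ where the hidden constants depend only on $T$ and $\rho$. Moreover, $$\sum_{i=1}^n\Big(\sum_{j=1}^n\xi_{ij}\xi_{ji}\Big)^2\lesssim D_T(\xi)\lesssim\sum_{i=1}^n\Big(\sum_{j=1}^n\xi_{ij}^2\Big)^2+\sum_{i=1}^n\Big(\sum_{j=1}^n\xi_{ji}^2\Big)^2,$$ with hidden constants depending only on $T$ and $\rho$, and thus if $\xi$ is symmetric then the term $D_T(\xi)$ can be discarded from the first display (i.e. the two-sided estimate remains true without it).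
   Context: $P_t$ is the law on $\mathbb R^n$ of $(X^1_t,\dots,X^n_t)$ solving the linear SDE system $dX^i_t=\sum_{j\ne i}\xi_{ij}X^j_t\,dt+dB^i_t$, $X^i_0=0$, $i\in[n]=\{1,\dots,n\}$, with $B^1,\dots,B^n$ independent one-dimensional Brownian motions; thus $P_t$ is the centered Gaussian with covariance $\Sigma_t=\int_0^te^{s\xi}e^{s\xi^\top}ds$. $Q_t$ is the law of the solution of $dY^i_t=\sum_{j\ne i}\xi_{ij}\mathbb E[Y^j_t]\,dt+dB^i_t$, $Y^i_0=0$, i.e. the centered Gaussian with covariance $tI$. For $v\subset[n]$, $P^v_t,Q^v_t$ are the marginal laws of the coordinates in $v$. $H(\nu|\mu)=\int\log\frac{d\nu}{d\mu}d\nu$ is relative entropy. $a\lesssim b$ means $a\le cb$ for a constant $c\in(0,\infty)$ of the indicated dependence; $a\asymp b$ means $a\lesssim b$ and $b\lesssim a$. *)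

theory Defs
  imports
    "HOL-Probability.Probability"
    "Jordan_Normal_Form.Gauss_Jordan_Elimination"
    "Jordan_Normal_Form.Determinant"
begin

text \<open>
  The constants in the theorem are uniform in the dimension, so the dimension must be an ordinary
  natural number: matrices are those of \<^theory>\<open>Jordan_Normal_Form.Matrix\<close>, \<open>\<real>\<^sup>n\<close> is the product
  space over \<open>{..<n}\<close>, and the index set \<open>{1, \<dots>, n}\<close> is shifted to \<open>{0, \<dots>, n - 1}\<close>.
\<close>

definition euclidean_norm :: "real Matrix.vec \<Rightarrow> real" where
  "euclidean_norm x = sqrt (\<Sum>i<dim_vec x. (vec_index x i)\<^sup>2)"

definition op_norm :: "real mat \<Rightarrow> real" where
  "op_norm A = (SUP x\<in>{x \<in> carrier_vec (dim_col A). euclidean_norm x \<le> 1}. euclidean_norm (A *\<^sub>v x))"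

definition mat_exp :: "real mat \<Rightarrow> real mat" where
  "mat_exp A = Matrix.mat (dim_row A) (dim_row A)
     (\<lambda>(i, j). \<Sum>m. (A ^\<^sub>m m) $$ (i, j) / fact m)"

definition covariance :: "real mat \<Rightarrow> real \<Rightarrow> real mat" where
  "covariance \<xi> t = Matrix.mat (dim_row \<xi>) (dim_row \<xi>)
     (\<lambda>(i, j). integral {0..t}
        (\<lambda>s. (mat_exp (s \<cdot>\<^sub>m \<xi>) * mat_exp (s \<cdot>\<^sub>m transpose_mat \<xi>)) $$ (i, j)))"

text \<open>
  Centered Gaussian law with positive definite covariance \<open>S\<close>, given by its Lebesgue density.
\<close>

definition gaussian_law :: "real mat \<Rightarrow> (nat \<Rightarrow> real) measure" where
  "gaussian_law S = (let n = dim_row S; K = the (mat_inverse S) in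
     density (\<Pi>\<^sub>M i\<in>{..<n}. lborel)
       (\<lambda>x. ennreal (exp (- (\<Sum>i<n. \<Sum>j<n. x i * K $$ (i, j) * x j) / 2)
                     / sqrt ((2 * pi) ^ n * Determinant.det S))))"

definition P_law :: "real mat \<Rightarrow> real \<Rightarrow> (nat \<Rightarrow> real) measure" where
  "P_law \<xi> t = gaussian_law (covariance \<xi> t)"

definition Q_law :: "nat \<Rightarrow> real \<Rightarrow> (nat \<Rightarrow> real) measure" where
  "Q_law n t = gaussian_law (t \<cdot>\<^sub>m 1\<^sub>m n)"

definition marginal :: "nat set \<Rightarrow> (nat \<Rightarrow> real) measure \<Rightarrow> (nat \<Rightarrow> real) measure" where
  "marginal v M = distr M (\<Pi>\<^sub>M i\<in>v. borel) (\<lambda>x. restrict x v)"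

text \<open>
  The library's divergence takes the reference measure first. It is real-valued, which is harmless
  here because the marginals compared below are equivalent nondegenerate Gaussians.
\<close>

definition rel_entropy :: "'a measure \<Rightarrow> 'a measure \<Rightarrow> real" where
  "rel_entropy \<nu> \<mu> = KL_divergence (exp 1) \<mu> \<nu>"

definition avg_entropy :: "real mat \<Rightarrow> real \<Rightarrow> nat \<Rightarrow> real" where
  "avg_entropy \<xi> T k = (let n = dim_row \<xi> in
     (\<Sum>v | v \<subseteq> {..<n} \<and> card v = k.
        rel_entropy (marginal v (P_law \<xi> T)) (marginal v (Q_law n T)))
     / real (n choose k))"

definition D_term :: "real \<Rightarrow> real mat \<Rightarrow> real" where
  "D_term T \<xi> = (\<Sum>i<dim_row \<xi>.
     (\<Sum>\<^sub>\<infinity>m\<in>{2..}. T ^ m / fact (m + 1) * (\<xi> ^\<^sub>m m) $$ (i, i))\<^sup>2)"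

definition interaction_matrix :: "nat \<Rightarrow> real \<Rightarrow> real mat \<Rightarrow> bool" where
  "interaction_matrix n \<rho> \<xi> \<longleftrightarrow>
     \<xi> \<in> carrier_mat n n \<and>
     (\<forall>i<n. \<forall>j<n. 0 \<le> \<xi> $$ (i, j)) \<and>
     (\<forall>i<n. \<xi> $$ (i, i) = 0) \<and>
     op_norm \<xi> = \<rho>"

end

theory Submission
  imports Defs
begin

text \<open>
  Write \<open>\<Sigma>\<^sub>T = T (I + M)\<close>. The entropy of the marginals on \<open>v\<close> is
  \<open>(tr M\<^sub>v - log det (I + M\<^sub>v)) / 2\<close>. Adding one coordinate \<open>j\<close> to \<open>v\<close> increases it by
  \<open>(p - 1 - ln p + q) / 2\<close>, where \<open>p\<close> is the residual variance of coordinate \<open>j\<close> given \<open>v\<close> and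
  \<open>q\<close> the variance explained by \<open>v\<close>, both relative to \<open>T\<close>. As the spectrum of \<open>I + M\<close> stays in
  \<open>[1/4, 2]\<close>, this increment is comparable to \<open>M\<^sub>j\<^sub>j\<^sup>2 + 2 \<Sum>\<^sub>i M\<^sub>i\<^sub>j\<^sup>2\<close>, so the entropy is comparable to the
  squared Frobenius norm of \<open>M\<^sub>v\<close>. Averaging over \<open>v\<close> leaves the Frobenius norm of \<open>M\<close> and the sum of
  the squared diagonal entries. With \<open>F\<^sub>s = exp (s \<xi>) - I\<close> one has
  \<open>M = T\<^sup>-\<^sup>1 \<integral> (F\<^sub>s + F\<^sub>s\<^sup>t + F\<^sub>s F\<^sub>s\<^sup>t) ds\<close>; the first two terms contribute twice the series in
  \<open>D\<^sub>T\<close> to \<open>M\<^sub>i\<^sub>i\<close>, the last one a quantity comparable to \<open>\<Sum>\<^sub>j \<xi>\<^sub>i\<^sub>j\<^sup>2\<close>, because \<open>F\<^sub>s\<close> is \<open>\<xi>\<close>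
  times a bounded operator and dominates \<open>s \<xi>\<close> entrywise.
\<close>

subsection \<open>Gaussian densities on finite sets of coordinates\<close>

text \<open>No constant may depend on \<open>n\<close>. The estimates therefore rest on operator
  norms and on the nonnegativity of the entries: without cancellation, a single term of the
  exponential series is already a lower bound for the whole. The restriction on \<open>T\<close>
  enters as \<open>(exp (s * \<rho>))\<^sup>2 \<le> 2\<close>, which keeps the norm of
  \<open>F s\<close> below 1/2 and so produces the interval for the spectrum. Proceeding one
  coordinate at a time replaces diagonalisation by a scalar inequality: \<open>p - 1 - ln p\<close>
  and \<open>q\<close> are both nonnegative, so neither can hide the other. The same one-coordinate
  step also constructs the Gaussian laws: normalization, second moments, marginals and the
  determinant as a product of residual variances all come from it. Covariances are functions of two
  indices, read only on a finite index set. Passing to a marginal then changes the set and leaves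
  \<open>S\<close> as it is.\<close>

definition quad_form :: "nat set \<Rightarrow> (nat \<Rightarrow> nat \<Rightarrow> real) \<Rightarrow> (nat \<Rightarrow> real) \<Rightarrow> real" where
  "quad_form w K x = (\<Sum>i\<in>w. \<Sum>j\<in>w. x i * K i j * x j)"

abbreviation lebesgue_on_coords :: "nat set \<Rightarrow> (nat \<Rightarrow> real) measure" where
  "lebesgue_on_coords w \<equiv> Pi\<^sub>M w (\<lambda>_. lborel)"

definition gauss_density :: "nat set \<Rightarrow> (nat \<Rightarrow> nat \<Rightarrow> real) \<Rightarrow> real \<Rightarrow> (nat \<Rightarrow> real) \<Rightarrow> real" where
  "gauss_density w K c x = c * exp (- quad_form w K x / 2)"

definition symmetric_on :: "nat set \<Rightarrow> (nat \<Rightarrow> nat \<Rightarrow> real) \<Rightarrow> bool" where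
  "symmetric_on w S \<longleftrightarrow> (\<forall>i\<in>w. \<forall>j\<in>w. S i j = S j i)"

definition posdef_on :: "nat set \<Rightarrow> (nat \<Rightarrow> nat \<Rightarrow> real) \<Rightarrow> bool" where
  "posdef_on w S \<longleftrightarrow> (\<forall>x. (\<exists>i\<in>w. x i \<noteq> 0) \<longrightarrow> 0 < quad_form w S x)"

definition left_inverse_on :: "nat set \<Rightarrow> (nat \<Rightarrow> nat \<Rightarrow> real) \<Rightarrow> (nat \<Rightarrow> nat \<Rightarrow> real) \<Rightarrow> bool" where
  "left_inverse_on w K S \<longleftrightarrow>
     (\<forall>i\<in>w. \<forall>j\<in>w. (\<Sum>l\<in>w. K i l * S l j) = (if i = j then 1 else 0))"

text \<open>The normalizer \<open>c\<close> stays abstract because unit mass determines it; its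
  determinant formula matters only for the comparison with \<open>gaussian_law\<close>. Mass and
  second moments are what a relative entropy consumes, the log-ratio of two such densities being a
  quadratic polynomial.\<close>

definition gaussian_on ::
  "nat set \<Rightarrow> (nat \<Rightarrow> nat \<Rightarrow> real) \<Rightarrow> (nat \<Rightarrow> nat \<Rightarrow> real) \<Rightarrow> real \<Rightarrow> bool" where
  "gaussian_on w S K c \<longleftrightarrow>
     finite w \<and> 0 < c \<and> symmetric_on w S \<and> symmetric_on w K \<and> left_inverse_on w K S \<and>
     (\<integral>\<^sup>+ x. gauss_density w K c x \<partial>lebesgue_on_coords w) = 1 \<and>
     (\<forall>i\<in>w. \<forall>j\<in>w. has_bochner_integral (lebesgue_on_coords w)
        (\<lambda>x. gauss_density w K c x * (x i * x j)) (S i j))"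

interpretation lborel_product: product_sigma_finite "\<lambda>_::nat. lborel :: real measure"
  by standard

lemma quad_form_measurable [measurable]:
  "quad_form w K \<in> borel_measurable (lebesgue_on_coords w)"
  unfolding quad_form_def by measurable

lemma gauss_density_measurable [measurable]:
  "gauss_density w K c \<in> borel_measurable (lebesgue_on_coords w)"
  unfolding gauss_density_def by measurable

lemma quad_form_cong:
  "(\<And>i. i \<in> w \<Longrightarrow> x i = y i) \<Longrightarrow> quad_form w K x = quad_form w K y"
  unfolding quad_form_def by (intro sum.cong) auto

lemma gauss_density_cong:
  "(\<And>i. i \<in> w \<Longrightarrow> x i = y i) \<Longrightarrow> gauss_density w K c x = gauss_density w K c y"
  unfolding gauss_density_def using quad_form_cong by metis

lemma gauss_density_pos: "0 < c \<Longrightarrow> 0 < gauss_density w K c x"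
  unfolding gauss_density_def by simp

lemma right_inverse_if_symmetric:
  assumes "left_inverse_on w K S" "symmetric_on w S" "symmetric_on w K" "i \<in> w" "j \<in> w"
  shows "(\<Sum>l\<in>w. S i l * K l j) = (if i = j then 1 else 0)"
proof -
  have "(\<Sum>l\<in>w. S i l * K l j) = (\<Sum>l\<in>w. K j l * S l i)"
    using assms by (intro sum.cong) (auto simp: symmetric_on_def)
  also have "\<dots> = (if i = j then 1 else 0)"
    using assms by (auto simp: left_inverse_on_def)
  finally show ?thesis .
qed

lemma left_inverse_on_unique:
  assumes fin: "finite w"
    and K1: "left_inverse_on w K1 S"
    and K2: "left_inverse_on w K2 S" "symmetric_on w K2" and S: "symmetric_on w S"
    and ij: "i \<in> w" "j \<in> w"
  shows "K1 i j = K2 i j"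
proof -
  have "K1 i j = (\<Sum>l\<in>w. K1 i l * (if l = j then 1 else 0))"
    using fin ij by (simp add: if_distrib cong: if_cong)
  also have "\<dots> = (\<Sum>l\<in>w. K1 i l * (\<Sum>m\<in>w. S l m * K2 m j))"
    using right_inverse_if_symmetric[OF K2(1) S K2(2) _ ij(2)] by simp
  also have "\<dots> = (\<Sum>l\<in>w. \<Sum>m\<in>w. K1 i l * S l m * K2 m j)"
    by (simp add: sum_distrib_left mult.assoc)
  also have "\<dots> = (\<Sum>m\<in>w. (\<Sum>l\<in>w. K1 i l * S l m) * K2 m j)"
    by (subst sum.swap) (simp add: sum_distrib_right)
  also have "\<dots> = (\<Sum>m\<in>w. (if i = m then 1 else 0) * K2 m j)"
    using K1 ij by (intro sum.cong) (auto simp: left_inverse_on_def)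
  also have "\<dots> = K2 i j"
    using fin ij by (simp add: if_distrib[of "\<lambda>t. t * _"] cong: if_cong)
  finally show ?thesis .
qed

text \<open>The inverse is unique on \<open>w\<close>, and \<open>quad_form w\<close> reads nothing
  outside \<open>w\<close>; unit mass then fixes the constant. This allows a given Gaussian to be
  replaced by the one that an induction builds.\<close>

lemma gaussian_on_unique:
  assumes 1: "gaussian_on w S K1 c1" and 2: "gaussian_on w S K2 c2"
  shows "c1 = c2" "gauss_density w K1 c1 = gauss_density w K2 c2"
proof -
  have K: "K1 i j = K2 i j" if "i \<in> w" "j \<in> w" for i j
    using left_inverse_on_unique[of w K1 S K2 i j] that 1 2 by (auto simp: gaussian_on_def)
  have q: "quad_form w K1 = quad_form w K2"
    unfolding quad_form_def by (intro ext sum.cong) (auto simp: K)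
  have c: "0 < c1" "0 < c2" using 1 2 by (auto simp: gaussian_on_def)
  define J where "J = (\<integral>\<^sup>+ x. ennreal (exp (- quad_form w K2 x / 2)) \<partial>lebesgue_on_coords w)"
  have I: "(\<integral>\<^sup>+ x. gauss_density w K2 c x \<partial>lebesgue_on_coords w) = ennreal c * J" if "0 < c" for c
    unfolding gauss_density_def J_def using that
    by (simp add: ennreal_mult' nn_integral_cmult)
  have e: "ennreal c1 * J = 1" "ennreal c2 * J = 1"
    using 1 2 I[OF c(1)] I[OF c(2)] by (simp_all add: gaussian_on_def gauss_density_def q)
  \<comment> \<open>Exchanging the factors avoids a division by \<open>J\<close> in the extended
    reals.\<close>
  have "ennreal c1 = ennreal c1 * (ennreal c2 * J)" by (simp add: e)
  also have "\<dots> = ennreal c2 * (ennreal c1 * J)" by (simp add: ac_simps)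
  also have "\<dots> = ennreal c2" by (simp add: e)
  finally show "c1 = c2" using c by simp
  then show "gauss_density w K1 c1 = gauss_density w K2 c2"
    by (simp add: gauss_density_def q fun_eq_iff)
qed

lemma gaussian_on_empty: "gaussian_on {} S K 1"
  by (simp add: gaussian_on_def symmetric_on_def left_inverse_on_def gauss_density_def
      quad_form_def PiM_empty nn_integral_count_space_finite)

lemma quad_form_insert:
  assumes "finite u" "j \<notin> u"
  shows "quad_form (insert j u) K x =
    quad_form u K x + (\<Sum>i\<in>u. x i * K i j) * x j + x j * (\<Sum>i\<in>u. K j i * x i) + K j j * (x j)\<^sup>2"
proof -
  have "quad_form (insert j u) K x =
      (x j * K j j * x j + (\<Sum>i\<in>u. x j * K j i * x i)) + (\<Sum>i\<in>u. x i * K i j * x j + (\<Sum>l\<in>u. x i * K i l * x l))"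
    using assms by (simp add: quad_form_def)
  also have "(\<Sum>i\<in>u. x j * K j i * x i) = x j * (\<Sum>i\<in>u. K j i * x i)"
    by (simp add: sum_distrib_left mult.assoc)
  also have "(\<Sum>i\<in>u. x i * K i j * x j + (\<Sum>l\<in>u. x i * K i l * x l))
      = (\<Sum>i\<in>u. x i * K i j) * x j + quad_form u K x"
    by (simp add: sum.distrib sum_distrib_right quad_form_def)
  finally show ?thesis by (simp add: power2_eq_square)
qed

text \<open>Conditionally on the coordinates in \<open>u\<close>, coordinate \<open>j\<close> is Gaussian with mean \<open>\<beta> \<cdot> x\<close> and
  variance \<open>p\<close>; the precision matrix on \<open>insert j u\<close> is read off from the product density.\<close>

definition regression_coeff :: "nat set \<Rightarrow> (nat \<Rightarrow> nat \<Rightarrow> real) \<Rightarrow> (nat \<Rightarrow> nat \<Rightarrow> real) \<Rightarrow> nat \<Rightarrow> nat \<Rightarrow> real" where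
  "regression_coeff u S K j i = (\<Sum>l\<in>u. K i l * S l j)"

definition residual_var :: "nat set \<Rightarrow> (nat \<Rightarrow> nat \<Rightarrow> real) \<Rightarrow> (nat \<Rightarrow> nat \<Rightarrow> real) \<Rightarrow> nat \<Rightarrow> real" where
  "residual_var u S K j = S j j - (\<Sum>l\<in>u. regression_coeff u S K j l * S l j)"

text \<open>Block inversion: \<open>K\<close> padded with zeros plus a rank-one term, where
  \<open>b\<close> is the coefficient vector of the prediction error of coordinate \<open>j\<close>,
  up to sign.\<close>

definition extended_precision :: "nat set \<Rightarrow> (nat \<Rightarrow> nat \<Rightarrow> real) \<Rightarrow> (nat \<Rightarrow> nat \<Rightarrow> real) \<Rightarrow> nat \<Rightarrow> nat \<Rightarrow> nat \<Rightarrow> real" where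
  "extended_precision u S K j i l =
     (let b = (\<lambda>i. if i = j then -1 else regression_coeff u S K j i)
      in (if i = j \<or> l = j then 0 else K i l) + b i * b l / residual_var u S K j)"

locale gaussian_extension =
  fixes u :: "nat set" and S K :: "nat \<Rightarrow> nat \<Rightarrow> real" and c :: real and j :: nat
    and \<beta> :: "nat \<Rightarrow> real" and p :: real
  defines "\<beta> \<equiv> regression_coeff u S K j" and "p \<equiv> residual_var u S K j"
  assumes base: "gaussian_on u S K c" and j: "j \<notin> u"
    and sym: "symmetric_on (insert j u) S" and posdef: "posdef_on (insert j u) S"
begin

lemma fin: "finite u" and c_pos: "0 < c" and sym_u: "symmetric_on u S"
  and symK: "symmetric_on u K" and inv_u: "left_inverse_on u K S"
  and total: "(\<integral>\<^sup>+ x. gauss_density u K c x \<partial>lebesgue_on_coords u) = 1"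
  using base by (auto simp: gaussian_on_def)

lemma moment: "i \<in> u \<Longrightarrow> l \<in> u \<Longrightarrow> has_bochner_integral (lebesgue_on_coords u)
        (\<lambda>x. gauss_density u K c x * (x i * x l)) (S i l)"
  using base by (auto simp: gaussian_on_def)

text \<open>The coefficients are \<open>K\<close> applied to column \<open>j\<close> of
  \<open>S\<close>, and by symmetry \<open>K\<close> is a right inverse too. These are the normal
  equations for predicting coordinate \<open>j\<close> linearly from \<open>u\<close>.\<close>

lemma normal_equation:
  assumes "i \<in> u" shows "(\<Sum>l\<in>u. S i l * \<beta> l) = S i j"
proof -
  have "(\<Sum>l\<in>u. S i l * \<beta> l) = (\<Sum>l\<in>u. \<Sum>m\<in>u. S i l * K l m * S m j)"
    by (simp add: \<beta>_def regression_coeff_def sum_distrib_left mult.assoc)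
  also have "\<dots> = (\<Sum>m\<in>u. (\<Sum>l\<in>u. S i l * K l m) * S m j)"
    by (subst sum.swap) (simp add: sum_distrib_right)
  also have "\<dots> = (\<Sum>m\<in>u. (if i = m then 1 else 0) * S m j)"
    using right_inverse_if_symmetric[OF inv_u sym_u symK assms] by simp
  also have "\<dots> = S i j"
    using assms fin by (simp add: if_distrib[of "\<lambda>t. t * _"] cong: if_cong)
  finally show ?thesis .
qed

lemma p_eq: "p = S j j - (\<Sum>l\<in>u. \<beta> l * S l j)"
  by (simp add: p_def residual_var_def \<beta>_def)

lemma symj: "i \<in> u \<Longrightarrow> S j i = S i j"
  using sym unfolding symmetric_on_def by blast

lemma quad_form_beta: "quad_form u S \<beta> = (\<Sum>l\<in>u. \<beta> l * S l j)"
proof -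
  have "quad_form u S \<beta> = (\<Sum>l\<in>u. \<beta> l * (\<Sum>i\<in>u. S l i * \<beta> i))"
    by (simp add: quad_form_def sum_distrib_left mult.assoc)
  also have "\<dots> = (\<Sum>l\<in>u. \<beta> l * S l j)" by (simp add: normal_equation)
  finally show ?thesis .
qed

text \<open>The vector \<open>\<beta>(j := -1)\<close> represents the prediction error, whose
  variance under \<open>S\<close> is \<open>p\<close>. In this form positive definiteness gives
  \<open>0 < p\<close>, and a lower bound on the quadratic form gives a lower bound on
  \<open>p\<close>.\<close>

lemma p_eq_quad_form: "p = quad_form (insert j u) S (\<beta>(j := -1))"
proof -
  have "quad_form u S (\<beta>(j := -1)) = quad_form u S \<beta>"
    using j by (intro quad_form_cong) auto
  moreover have "(\<Sum>i\<in>u. (\<beta>(j := -1)) i * S i j) = (\<Sum>i\<in>u. \<beta> i * S i j)"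
    using j by (intro sum.cong) auto
  moreover have "(\<Sum>i\<in>u. S j i * (\<beta>(j := -1)) i) = (\<Sum>i\<in>u. \<beta> i * S i j)"
    using j by (intro sum.cong) (auto simp: symj)
  ultimately show ?thesis
    using fin j by (simp add: quad_form_insert quad_form_beta p_eq)
qed

lemma p_pos: "0 < p"
  unfolding p_eq_quad_form using posdef unfolding posdef_on_def
  by (elim allE[of _ "\<beta>(j := -1)"]) auto

abbreviation "K' \<equiv> extended_precision u S K j"
abbreviation "c' \<equiv> c / sqrt (2 * pi * p)"
abbreviation "mean x \<equiv> \<Sum>i\<in>u. \<beta> i * x i"

lemma K'_simps:
  "i \<in> u \<Longrightarrow> l \<in> u \<Longrightarrow> K' i l = K i l + \<beta> i * \<beta> l / p"
  "i \<in> u \<Longrightarrow> K' i j = - \<beta> i / p"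
  "i \<in> u \<Longrightarrow> K' j i = - \<beta> i / p"
  "K' j j = 1 / p"
  using j by (auto simp: extended_precision_def Let_def \<beta>_def p_def)

lemma symmetric_K': "symmetric_on (insert j u) K'"
  using symK by (auto simp: symmetric_on_def K'_simps)

lemma left_inverse_K': "left_inverse_on (insert j u) K' S"
proof -
  have a: "(\<Sum>l\<in>u. \<beta> l * S l i) = S i j" if "i \<in> u" for i
  proof -
    have "(\<Sum>l\<in>u. \<beta> l * S l i) = (\<Sum>l\<in>u. S i l * \<beta> l)"
      using sym_u that by (intro sum.cong) (auto simp: symmetric_on_def)
    then show ?thesis using normal_equation[OF that] by simp
  qed
  have p: "p \<noteq> 0" using p_pos by simp
  have 1: "(\<Sum>l\<in>u. K' i l * S l m) = (\<Sum>l\<in>u. K i l * S l m) + \<beta> i / p * (\<Sum>l\<in>u. \<beta> l * S l m)"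
    if "i \<in> u" for i m
    using that by (simp add: K'_simps algebra_simps sum.distrib sum_distrib_left)
  have 2: "(\<Sum>l\<in>u. K' j l * S l m) = - (\<Sum>l\<in>u. \<beta> l * S l m) / p" for m
    by (simp add: K'_simps sum_negf sum_divide_distrib)
  have 3: "(\<Sum>l\<in>u. K i l * S l j) = \<beta> i" for i
    by (simp add: \<beta>_def regression_coeff_def)
  have 4: "(\<Sum>l\<in>u. \<beta> l * S l j) = S j j - p" by (simp add: p_eq)
  show ?thesis
    unfolding left_inverse_on_def
  proof (intro ballI)
    fix i m assume im: "i \<in> insert j u" "m \<in> insert j u"
    have e: "(\<Sum>l\<in>insert j u. K' i l * S l m) = K' i j * S j m + (\<Sum>l\<in>u. K' i l * S l m)"
      using fin j by simp
    consider (jj) "i = j" "m = j" | (ju) "i = j" "m \<in> u" | (uj) "i \<in> u" "m = j" | (uu) "i \<in> u" "m \<in> u"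
      using im by auto
    then show "(\<Sum>l\<in>insert j u. K' i l * S l m) = (if i = m then 1 else 0)"
    proof cases
      case jj
      show ?thesis using p e unfolding jj 2 4 K'_simps by (simp add: field_simps)
    next
      case ju
      show ?thesis using p j e ju(2) unfolding ju(1) 2 a[OF ju(2)] K'_simps symj[OF ju(2)]
        by (auto simp add: field_simps)
    next
      case uj
      show ?thesis
        using p j e uj(1) unfolding uj(2) 1[OF uj(1)] 3 4 K'_simps(2)[OF uj(1)] by (auto simp add: field_simps)
    next
      case uu
      then have "(\<Sum>l\<in>u. K i l * S l m) = (if i = m then 1 else 0)"
        using inv_u by (auto simp: left_inverse_on_def)
      then show ?thesis
        using p j e unfolding 1[OF uu(1)] a[OF uu(2)] K'_simps(2)[OF uu(1)] symj[OF uu(2)] by simp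
    qed
  qed
qed

text \<open>Completing the square in \<open>x j\<close>: the rank-one part of the precision is the
  squared prediction error divided by \<open>p\<close>.\<close>

lemma quad_form_K': "quad_form (insert j u) K' x = quad_form u K x + (x j - mean x)\<^sup>2 / p"
proof -
  have a: "quad_form u K' x = quad_form u K x + (mean x)\<^sup>2 / p"
  proof -
    have "quad_form u K' x = (\<Sum>i\<in>u. \<Sum>l\<in>u. x i * K i l * x l + (\<beta> i * x i) * (\<beta> l * x l) / p)"
      unfolding quad_form_def by (intro sum.cong refl) (simp add: K'_simps algebra_simps)
    also have "\<dots> = quad_form u K x + (mean x)\<^sup>2 / p"
      by (simp add: quad_form_def sum.distrib power2_eq_square sum_product sum_divide_distrib)
    finally show ?thesis .
  qed
  have b: "(\<Sum>i\<in>u. x i * K' i j) = - mean x / p"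
    by (simp add: K'_simps sum_negf sum_divide_distrib algebra_simps)
  have d: "(\<Sum>i\<in>u. K' j i * x i) = - mean x / p"
    by (simp add: K'_simps sum_negf sum_divide_distrib algebra_simps)
  show ?thesis
    unfolding quad_form_insert[OF fin j] a b d K'_simps using p_pos
    by (simp add: power2_eq_square field_simps)
qed

lemma density_factor:
  "gauss_density (insert j u) K' c' x =
     gauss_density u K c x * normal_density (mean x) (sqrt p) (x j)"
proof -
  have "exp (- (quad_form u K x + (x j - mean x)\<^sup>2 / p) / 2)
      = exp (- quad_form u K x / 2) * exp (- (x j - mean x)\<^sup>2 / (2 * p))"
    using p_pos by (simp add: exp_add[symmetric] add_divide_distrib)
  then show ?thesis
    using p_pos unfolding gauss_density_def quad_form_K' normal_density_def by simp
qed

lemma density_factor_upd: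
  "gauss_density (insert j u) K' c' (x(j := y)) =
     gauss_density u K c x * normal_density (mean x) (sqrt p) y"
proof -
  have "mean (x(j := y)) = mean x" using j by (intro sum.cong) auto
  moreover have "gauss_density u K c (x(j := y)) = gauss_density u K c x"
    using j by (intro gauss_density_cong) auto
  ultimately show ?thesis unfolding density_factor by simp
qed

end

subsection \<open>Extension by one coordinate\<close>

lemma nn_integral_normal_density:
  "0 < \<sigma> \<Longrightarrow> (\<integral>\<^sup>+ y. ennreal (normal_density \<mu> \<sigma> y) \<partial>lborel) = 1"
  by (subst nn_integral_eq_integral) auto

lemma second_moment_normal_density:
  assumes "0 < \<sigma>"
  shows "has_bochner_integral lborel (\<lambda>y. normal_density \<mu> \<sigma> y * y\<^sup>2) (\<sigma>\<^sup>2 + \<mu>\<^sup>2)"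
proof -
  have a: "has_bochner_integral lborel (\<lambda>y. normal_density \<mu> \<sigma> y * (y - \<mu>)\<^sup>2) (\<sigma>\<^sup>2)"
    using normal_moment_even[OF assms, of \<mu> 1] by simp
  have b: "has_bochner_integral lborel (\<lambda>y. 2 * \<mu> * (normal_density \<mu> \<sigma> y * y)) (2 * \<mu> * \<mu>)"
    by (intro has_bochner_integral_mult_right normal_moment_nz_1 assms)
  have c: "has_bochner_integral lborel (\<lambda>y. \<mu>\<^sup>2 * normal_density \<mu> \<sigma> y) (\<mu>\<^sup>2 * 1)"
    using assms by (intro has_bochner_integral_mult_right) (simp add: has_bochner_integral_iff)
  show ?thesis
    using has_bochner_integral_diff[OF has_bochner_integral_add[OF a b] c]
    by (rule has_bochner_integral_cong[THEN iffD1, rotated 3])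
      (simp_all add: power2_eq_square algebra_simps)
qed

lemma abs_mult_le_sum_squares: "\<bar>a * b\<bar> \<le> a * a + b * (b :: real)"
proof -
  have "2 * \<bar>a * b\<bar> \<le> a * a + b * b"
    using sum_squares_bound[of "\<bar>a\<bar>" "\<bar>b\<bar>"] by (simp add: abs_mult power2_eq_square)
  moreover have "0 \<le> \<bar>a * b\<bar>" by simp
  ultimately show ?thesis by linarith
qed

context gaussian_extension
begin

lemma restrict_measurable [measurable]:
  "(\<lambda>x. restrict x u) \<in> lebesgue_on_coords (insert j u) \<rightarrow>\<^sub>M lebesgue_on_coords u"
  by (rule measurable_restrict_subset) auto

text \<open>For fixed old coordinates the factorised density leaves a normal density in the new one,
  which integrates to 1.\<close>

lemma marginal_extension:
  "distr (density (lebesgue_on_coords (insert j u)) (gauss_density (insert j u) K' c'))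
     (lebesgue_on_coords u) (\<lambda>x. restrict x u)
   = density (lebesgue_on_coords u) (gauss_density u K c)" (is "?D = ?E")
proof (rule measure_eqI)
  show "sets ?D = sets ?E" by simp
  fix A assume "A \<in> sets ?D"
  then have A [measurable]: "A \<in> sets (lebesgue_on_coords u)" by simp
  let ?g = "\<lambda>x. ennreal (gauss_density (insert j u) K' c' x) * indicator A (restrict x u)"
  have "emeasure ?D A = (\<integral>\<^sup>+ x. ennreal (gauss_density (insert j u) K' c' x)
      * indicator ((\<lambda>x. restrict x u) -` A \<inter> space (lebesgue_on_coords (insert j u))) x
      \<partial>lebesgue_on_coords (insert j u))"
    by (simp add: emeasure_distr emeasure_density)
  also have "\<dots> = (\<integral>\<^sup>+ x. ?g x \<partial>lebesgue_on_coords (insert j u))"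
    by (intro nn_integral_cong) (auto simp: indicator_def)
  also have "\<dots> = (\<integral>\<^sup>+ x. \<integral>\<^sup>+ y. ?g (x(j := y)) \<partial>lborel \<partial>lebesgue_on_coords u)"
    by (intro lborel_product.product_nn_integral_insert fin j) measurable
  also have "\<dots> = (\<integral>\<^sup>+ x. ennreal (gauss_density u K c x) * indicator A x \<partial>lebesgue_on_coords u)"
  proof (intro nn_integral_cong)
    fix x assume "x \<in> space (lebesgue_on_coords u)"
    \<comment> \<open>Points of the product space are \<open>undefined\<close> outside
      \<open>u\<close>, so updating at \<open>j\<close> and restricting to \<open>u\<close> returns
      \<open>x\<close> itself.\<close>
    then have "x \<in> extensional u" by (simp add: space_PiM PiE_def)
    then have r: "restrict (x(j := y)) u = x" for y
      using j by (auto simp: extensional_def restrict_def)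
    have "(\<integral>\<^sup>+ y. ?g (x(j := y)) \<partial>lborel)
        = (\<integral>\<^sup>+ y. (ennreal (gauss_density u K c x) * indicator A x) *
             ennreal (normal_density (mean x) (sqrt p) y) \<partial>lborel)"
      unfolding density_factor_upd r
      by (intro nn_integral_cong)
        (simp add: ennreal_mult gauss_density_pos[OF c_pos] less_imp_le ac_simps)
    also have "\<dots> = ennreal (gauss_density u K c x) * indicator A x"
      using p_pos by (subst nn_integral_cmult) (auto simp: nn_integral_normal_density)
    finally show "(\<integral>\<^sup>+ y. ?g (x(j := y)) \<partial>lborel) = ennreal (gauss_density u K c x) * indicator A x" .
  qed
  also have "\<dots> = emeasure ?E A"
    by (simp add: emeasure_density)
  finally show "emeasure ?D A = emeasure ?E A" .
qed

lemma c'_pos: "0 < c'"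
  using c_pos p_pos by simp

text \<open>Integrals of functions of the old coordinates survive the extension. The constant 1
  gives the total mass, products of two coordinates give the old moments.\<close>

lemma has_bochner_integral_marginal:
  assumes g [measurable]: "g \<in> borel_measurable (lebesgue_on_coords u)"
    and h: "has_bochner_integral (lebesgue_on_coords u) (\<lambda>x. gauss_density u K c x * g x) v"
  shows "has_bochner_integral (lebesgue_on_coords (insert j u))
    (\<lambda>x. gauss_density (insert j u) K' c' x * g (restrict x u)) (v :: real)"
proof -
  let ?D = "density (lebesgue_on_coords (insert j u)) (gauss_density (insert j u) K' c')"
  have "has_bochner_integral (density (lebesgue_on_coords u) (gauss_density u K c)) g v"
    using h gauss_density_pos[OF c_pos]
    by (intro has_bochner_integral_density) (auto simp: less_imp_le)
  then have "has_bochner_integral (distr ?D (lebesgue_on_coords u) (\<lambda>x. restrict x u)) g v"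
    by (simp add: marginal_extension)
  then have "has_bochner_integral ?D (\<lambda>x. g (restrict x u)) v"
    by (simp add: has_bochner_integral_iff integrable_distr_eq integral_distr)
  then show ?thesis
    using gauss_density_pos[OF c'_pos]
    by (simp add: has_bochner_integral_iff integrable_density integral_density less_imp_le)
qed

lemma total_real: "has_bochner_integral (lebesgue_on_coords u) (gauss_density u K c) 1"
  using total gauss_density_pos[OF c_pos]
  by (intro has_bochner_integral_nn_integral) (auto simp: less_imp_le)

lemma total_extension:
  "(\<integral>\<^sup>+ x. gauss_density (insert j u) K' c' x \<partial>lebesgue_on_coords (insert j u)) = 1"
proof -
  have "has_bochner_integral (lebesgue_on_coords (insert j u)) (gauss_density (insert j u) K' c') 1"
    using has_bochner_integral_marginal[of "\<lambda>_. 1" 1] total_real by simp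
  then show ?thesis
    using gauss_density_pos[OF c'_pos]
    by (subst nn_integral_eq_integral) (auto simp: has_bochner_integral_iff less_imp_le)
qed

lemma moment_old:
  assumes "i \<in> u" "l \<in> u"
  shows "has_bochner_integral (lebesgue_on_coords (insert j u))
    (\<lambda>x. gauss_density (insert j u) K' c' x * (x i * x l)) (S i l)"
  using has_bochner_integral_marginal[OF _ moment[OF assms]] assms by simp

text \<open>Given the old coordinates, the new one has second moment
  \<open>p + (mean x)\<^sup>2\<close>, and the squared mean averages to
  \<open>quad_form u S \<beta>\<close>, that is \<open>S j j - p\<close>. As the integrand is
  nonnegative, the computation yields integrability along with the value.\<close>

lemma moment_new_new:
  "has_bochner_integral (lebesgue_on_coords (insert j u))
    (\<lambda>x. gauss_density (insert j u) K' c' x * (x j * x j)) (S j j)"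
proof -
  let ?d = "gauss_density (insert j u) K' c'"
  have m2: "has_bochner_integral (lebesgue_on_coords u) (\<lambda>x. gauss_density u K c x * (p + (mean x)\<^sup>2)) (S j j)"
  proof -
    have "has_bochner_integral (lebesgue_on_coords u)
       (\<lambda>x. p * gauss_density u K c x + (\<Sum>i\<in>u. \<Sum>l\<in>u. \<beta> i * \<beta> l * (gauss_density u K c x * (x i * x l))))
       (p * 1 + (\<Sum>i\<in>u. \<Sum>l\<in>u. \<beta> i * \<beta> l * S i l))"
      by (intro has_bochner_integral_add has_bochner_integral_sum has_bochner_integral_mult_right
          total_real moment)
    moreover have "(\<Sum>i\<in>u. \<Sum>l\<in>u. \<beta> i * \<beta> l * S i l) = S j j - p"
      using quad_form_beta p_eq by (simp add: quad_form_def ac_simps)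
    moreover have "p * gauss_density u K c x + (\<Sum>i\<in>u. \<Sum>l\<in>u. \<beta> i * \<beta> l * (gauss_density u K c x * (x i * x l)))
        = gauss_density u K c x * (p + (mean x)\<^sup>2)" for x
      by (simp add: power2_eq_square sum_product distrib_left sum_distrib_left ac_simps)
    ultimately show ?thesis by simp
  qed
  have nn: "0 \<le> ?d x" for x using gauss_density_pos[OF c'_pos] by (simp add: less_imp_le)
  have "(\<integral>\<^sup>+ x. ennreal (?d x * (x j * x j)) \<partial>lebesgue_on_coords (insert j u)) =
    (\<integral>\<^sup>+ x. \<integral>\<^sup>+ y. ennreal (?d (x(j := y)) * ((x(j := y)) j * (x(j := y)) j)) \<partial>lborel \<partial>lebesgue_on_coords u)"
    by (intro lborel_product.product_nn_integral_insert fin j) measurable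
  also have "\<dots> = (\<integral>\<^sup>+ x. ennreal (gauss_density u K c x * (p + (mean x)\<^sup>2)) \<partial>lebesgue_on_coords u)"
  proof (intro nn_integral_cong)
    fix x
    have "(\<integral>\<^sup>+ y. ennreal (?d (x(j := y)) * ((x(j := y)) j * (x(j := y)) j)) \<partial>lborel) =
       (\<integral>\<^sup>+ y. ennreal (gauss_density u K c x) * ennreal (normal_density (mean x) (sqrt p) y * y\<^sup>2) \<partial>lborel)"
      unfolding density_factor_upd
      by (intro nn_integral_cong, subst ennreal_mult[symmetric])
        (simp add: gauss_density_pos[OF c_pos] less_imp_le, simp, simp add: power2_eq_square ac_simps)
    also have "\<dots> = ennreal (gauss_density u K c x) *
        (\<integral>\<^sup>+ y. ennreal (normal_density (mean x) (sqrt p) y * y\<^sup>2) \<partial>lborel)"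
      by (intro nn_integral_cmult) auto
    also have "(\<integral>\<^sup>+ y. ennreal (normal_density (mean x) (sqrt p) y * y\<^sup>2) \<partial>lborel) = ennreal (p + (mean x)\<^sup>2)"
      using second_moment_normal_density[of "sqrt p" "mean x"] p_pos
      by (subst nn_integral_eq_integral) (auto simp: has_bochner_integral_iff)
    finally show "(\<integral>\<^sup>+ y. ennreal (?d (x(j := y)) * ((x(j := y)) j * (x(j := y)) j)) \<partial>lborel)
       = ennreal (gauss_density u K c x * (p + (mean x)\<^sup>2))"
      using p_pos gauss_density_pos[OF c_pos]
      by (subst ennreal_mult) (auto simp only: less_imp_le zero_le_power2 add_nonneg_nonneg)
  qed
  also have "\<dots> = ennreal (S j j)"
    using m2 p_pos gauss_density_pos[OF c_pos]
    by (subst nn_integral_eq_integral) (auto simp: has_bochner_integral_iff less_imp_le)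
  finally have I: "(\<integral>\<^sup>+ x. ennreal (?d x * (x j * x j)) \<partial>lebesgue_on_coords (insert j u)) = ennreal (S j j)" .
  have "0 \<le> integral\<^sup>L (lebesgue_on_coords u) (\<lambda>x. gauss_density u K c x * (p + (mean x)\<^sup>2))"
    using p_pos gauss_density_pos[OF c_pos]
    by (intro Bochner_Integration.integral_nonneg) (simp add: less_imp_le)
  then have "0 \<le> S j j"
    using m2 by (simp add: has_bochner_integral_iff)
  then show ?thesis
    using nn I by (intro has_bochner_integral_nn_integral) auto
qed

text \<open>This integrand changes sign, so integrability must precede the iterated integral; the
  two pure second moments provide it. The inner integral is \<open>mean x\<close>, and the normal
  equations give the value.\<close>

lemma moment_old_new:
  assumes i: "i \<in> u"
  shows "has_bochner_integral (lebesgue_on_coords (insert j u))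
    (\<lambda>x. gauss_density (insert j u) K' c' x * (x i * x j)) (S i j)"
proof -
  let ?d = "gauss_density (insert j u) K' c'" and ?M = "lebesgue_on_coords (insert j u)"
  have nn: "0 \<le> ?d x" for x using gauss_density_pos[OF c'_pos] by (simp add: less_imp_le)
  have [measurable]: "(\<lambda>x. x i) \<in> borel_measurable ?M" "(\<lambda>x. x j) \<in> borel_measurable ?M"
    using i by simp_all
  have "integrable ?M (\<lambda>x. ?d x * (x i * x i) + ?d x * (x j * x j))"
    using moment_old[OF i i] moment_new_new by (auto simp: has_bochner_integral_iff)
  then have int: "integrable ?M (\<lambda>x. ?d x * (x i * x j))"
  proof (rule Bochner_Integration.integrable_bound)
    show "AE x in ?M. norm (?d x * (x i * x j)) \<le> norm (?d x * (x i * x i) + ?d x * (x j * x j))"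
    proof (intro AE_I2)
      fix x :: "nat \<Rightarrow> real"
      have "\<bar>x i * x j\<bar> \<le> x i * x i + x j * x j"
        by (rule abs_mult_le_sum_squares)
      then have "?d x * \<bar>x i * x j\<bar> \<le> ?d x * (x i * x i + x j * x j)"
        using nn by (rule mult_left_mono)
      then show "norm (?d x * (x i * x j)) \<le> norm (?d x * (x i * x i) + ?d x * (x j * x j))"
        using nn[of x] by (simp add: abs_mult distrib_left)
    qed
  qed measurable
  have "integral\<^sup>L ?M (\<lambda>x. ?d x * (x i * x j)) =
     (\<integral>x. (\<integral>y. ?d (x(j := y)) * ((x(j := y)) i * (x(j := y)) j) \<partial>lborel) \<partial>lebesgue_on_coords u)"
    by (rule lborel_product.product_integral_insert[OF fin j int])
  also have "\<dots> = (\<integral>x. (\<Sum>l\<in>u. \<beta> l * (gauss_density u K c x * (x i * x l))) \<partial>lebesgue_on_coords u)"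
  proof (intro Bochner_Integration.integral_cong refl)
    fix x
    have ij: "i \<noteq> j" using i j by auto
    have "(\<integral>y. ?d (x(j := y)) * ((x(j := y)) i * (x(j := y)) j) \<partial>lborel)
      = (\<integral>y. (gauss_density u K c x * x i) * (normal_density (mean x) (sqrt p) y * y) \<partial>lborel)"
      unfolding density_factor_upd using ij by (simp add: ac_simps)
    also have "\<dots> = (gauss_density u K c x * x i) * mean x"
      using p_pos by (simp add: integral_normal_moment_nz_1)
    finally show "(\<integral>y. ?d (x(j := y)) * ((x(j := y)) i * (x(j := y)) j) \<partial>lborel)
       = (\<Sum>l\<in>u. \<beta> l * (gauss_density u K c x * (x i * x l)))"
      by (simp add: sum_distrib_left ac_simps)
  qed
  also have "\<dots> = (\<Sum>l\<in>u. \<beta> l * S i l)"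
  proof -
    have "has_bochner_integral (lebesgue_on_coords u)
        (\<lambda>x. \<Sum>l\<in>u. \<beta> l * (gauss_density u K c x * (x i * x l))) (\<Sum>l\<in>u. \<beta> l * S i l)"
      by (intro has_bochner_integral_sum has_bochner_integral_mult_right moment i)
    then show ?thesis by (simp add: has_bochner_integral_iff)
  qed
  also have "\<dots> = S i j"
    using normal_equation[OF i] by (simp add: mult.commute)
  finally show ?thesis using int by (simp add: has_bochner_integral_iff)
qed

theorem gaussian_on_extension: "gaussian_on (insert j u) S K' c'"
proof -
  have "has_bochner_integral (lebesgue_on_coords (insert j u))
        (\<lambda>x. gauss_density (insert j u) K' c' x * (x i * x l)) (S i l)"
    if il: "i \<in> insert j u" "l \<in> insert j u" for i l
  proof -
    consider "i = j" "l = j" | "i = j" "l \<in> u" | "i \<in> u" "l = j" | "i \<in> u" "l \<in> u"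
      using il by auto
    then show ?thesis
    proof cases
      case 1
      then show ?thesis using moment_new_new by simp
    next
      case 2
      then show ?thesis using moment_old_new[of l] symj[of l] by (simp add: mult.commute)
    next
      case 3
      then show ?thesis using moment_old_new by simp
    next
      case 4
      then show ?thesis by (rule moment_old)
    qed
  qed
  then show ?thesis
    using fin c'_pos sym symmetric_K' left_inverse_K' total_extension
    by (simp add: gaussian_on_def)
qed

end

subsection \<open>Marginals and relative entropy\<close>

definition scaled_identity :: "real \<Rightarrow> nat \<Rightarrow> nat \<Rightarrow> real" where
  "scaled_identity t i j = (if i = j then t else 0)"

lemma quad_form_zero_extension:
  assumes "finite w" "u \<subseteq> w"
  shows "quad_form w S (\<lambda>i. if i \<in> u then x i else 0) = quad_form u S x"
proof -
  let ?x = "\<lambda>i. if i \<in> u then x i else 0"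
  have "quad_form w S ?x = (\<Sum>i\<in>u. \<Sum>j\<in>w. ?x i * S i j * ?x j)"
    unfolding quad_form_def using assms by (intro sum.mono_neutral_right) auto
  also have "\<dots> = (\<Sum>i\<in>u. \<Sum>j\<in>u. ?x i * S i j * ?x j)"
    using assms by (intro sum.cong refl sum.mono_neutral_right) auto
  finally show ?thesis by (simp add: quad_form_def cong: sum.cong)
qed

lemma posdef_on_subset:
  assumes "posdef_on w S" "finite w" "u \<subseteq> w"
  shows "posdef_on u S"
  unfolding posdef_on_def
proof (intro allI impI)
  fix x :: "nat \<Rightarrow> real" assume "\<exists>i\<in>u. x i \<noteq> 0"
  then have "\<exists>i\<in>w. (if i \<in> u then x i else 0) \<noteq> 0" using assms by auto
  then have "0 < quad_form w S (\<lambda>i. if i \<in> u then x i else 0)"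
    using assms(1) unfolding posdef_on_def by (elim allE) (erule mp)
  then show "0 < quad_form u S x"
    by (simp add: quad_form_zero_extension assms)
qed

lemma symmetric_on_subset: "symmetric_on w S \<Longrightarrow> u \<subseteq> w \<Longrightarrow> symmetric_on u S"
  unfolding symmetric_on_def by blast

lemma gaussian_on_exists:
  assumes "finite w" "symmetric_on w S" "posdef_on w S"
  shows "\<exists>K c. gaussian_on w S K c"
  using assms
proof (induction w)
  case empty
  then show ?case using gaussian_on_empty by blast
next
  case (insert j u)
  then obtain K c where "gaussian_on u S K c"
    using posdef_on_subset[of "insert j u" S u] symmetric_on_subset[of "insert j u" S u] by auto
  then interpret gaussian_extension u S K c j "regression_coeff u S K j" "residual_var u S K j"
    using insert by unfold_locales auto
  show ?case using gaussian_on_extension by blast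
qed

text \<open>Marginalising is extending read backwards: starting from a Gaussian on \<open>u\<close>,
  the coordinates of \<open>w - u\<close> are added one by one, and none of them changes the
  marginal on \<open>u\<close>. Uniqueness identifies the result with the given Gaussian on
  \<open>w\<close>.\<close>

lemma gaussian_marginal:
  assumes w: "gaussian_on w S K c" "posdef_on w S" and u: "u \<subseteq> w"
  shows "\<exists>K1 c1. gaussian_on u S K1 c1 \<and>
    distr (density (lebesgue_on_coords w) (gauss_density w K c)) (lebesgue_on_coords u)
      (\<lambda>x. restrict x u) = density (lebesgue_on_coords u) (gauss_density u K1 c1)"
proof -
  have fin: "finite w" and sym: "symmetric_on w S" using w by (auto simp: gaussian_on_def)
  obtain K1 c1 where 1: "gaussian_on u S K1 c1"
    using gaussian_on_exists[of u S] fin u sym posdef_on_subset[OF w(2) fin u]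
      symmetric_on_subset[OF sym u] finite_subset by blast
  have "\<exists>K c. gaussian_on (u \<union> A) S K c \<and>
      distr (density (lebesgue_on_coords (u \<union> A)) (gauss_density (u \<union> A) K c)) (lebesgue_on_coords u)
        (\<lambda>x. restrict x u) = density (lebesgue_on_coords u) (gauss_density u K1 c1)"
    if "finite A" "A \<subseteq> w - u" for A
    using that
  proof (induction A)
    case empty
    have "distr (density (lebesgue_on_coords u) (gauss_density u K1 c1)) (lebesgue_on_coords u) (\<lambda>x. restrict x u)
      = distr (density (lebesgue_on_coords u) (gauss_density u K1 c1)) (density (lebesgue_on_coords u) (gauss_density u K1 c1)) (\<lambda>x. x)"
      by (intro distr_cong) (auto simp: space_PiM PiE_def extensional_restrict)
    then show ?case using 1 by (intro exI[of _ K1] exI[of _ c1]) (simp only: Un_empty_right distr_id simp_thms)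
  next
    case (insert j A)
    then have "A \<subseteq> w - u" by auto
    with insert.IH obtain K c where IH: "gaussian_on (u \<union> A) S K c"
      "distr (density (lebesgue_on_coords (u \<union> A)) (gauss_density (u \<union> A) K c)) (lebesgue_on_coords u)
        (\<lambda>x. restrict x u) = density (lebesgue_on_coords u) (gauss_density u K1 c1)"
      by blast
    let ?w = "u \<union> A"
    have j: "j \<notin> ?w" "insert j ?w \<subseteq> w" using insert u by auto
    interpret gaussian_extension ?w S K c j "regression_coeff ?w S K j" "residual_var ?w S K j"
      using IH j symmetric_on_subset[OF sym j(2)] posdef_on_subset[OF w(2) fin j(2)]
      by unfold_locales auto
    have "distr (density (lebesgue_on_coords (insert j ?w)) (gauss_density (insert j ?w) K' c'))
        (lebesgue_on_coords u) (\<lambda>x. restrict x u)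
      = distr (distr (density (lebesgue_on_coords (insert j ?w)) (gauss_density (insert j ?w) K' c'))
          (lebesgue_on_coords ?w) (\<lambda>x. restrict x ?w)) (lebesgue_on_coords u) (\<lambda>x. restrict x u)"
      by (subst distr_distr)
        (auto simp: comp_def restrict_restrict Int_absorb1 intro!: measurable_restrict_subset)
    also have "\<dots> = density (lebesgue_on_coords u) (gauss_density u K1 c1)"
      by (simp add: marginal_extension IH)
    finally show ?case unfolding Un_insert_right using gaussian_on_extension by blast
  qed
  moreover have "u \<union> (w - u) = w" "finite (w - u)" using fin u by auto
  ultimately obtain K2 c2 where 2: "gaussian_on w S K2 c2"
    "distr (density (lebesgue_on_coords w) (gauss_density w K2 c2)) (lebesgue_on_coords u)
        (\<lambda>x. restrict x u) = density (lebesgue_on_coords u) (gauss_density u K1 c1)"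
    by (metis order_refl)
  show ?thesis
    unfolding gaussian_on_unique(2)[OF w(1) 2(1)] using 1 2(2) by blast
qed

text \<open>The log-ratio is a constant plus quadratic forms, so its expectation is linear in the
  second moments \<open>S\<close>. The form of \<open>K\<close> itself contributes the trace of the
  identity, \<open>card w\<close>.\<close>

lemma rel_entropy_gaussian:
  assumes 1: "gaussian_on w S K c" and 2: "gaussian_on w S2 K2 c2"
  shows "rel_entropy (density (lebesgue_on_coords w) (gauss_density w K c))
      (density (lebesgue_on_coords w) (gauss_density w K2 c2))
    = ln c - ln c2 - card w / 2 + (\<Sum>i\<in>w. \<Sum>j\<in>w. K2 i j * S i j) / 2"
proof -
  have fin: "finite w" and c: "0 < c" "0 < c2" using 1 2 by (auto simp: gaussian_on_def)
  interpret finite_product_sigma_finite "\<lambda>_::nat. lborel :: real measure" w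
    using fin by unfold_locales
  let ?g = "gauss_density w K c"
  have total: "has_bochner_integral (lebesgue_on_coords w) ?g 1"
    using 1 gauss_density_pos[OF c(1)]
    by (intro has_bochner_integral_nn_integral) (auto simp: less_imp_le gaussian_on_def)
  have moment: "has_bochner_integral (lebesgue_on_coords w) (\<lambda>x. ?g x * (x i * x j)) (S i j)"
    if "i \<in> w" "j \<in> w" for i j
    using 1 that by (simp add: gaussian_on_def)
  have quad: "has_bochner_integral (lebesgue_on_coords w) (\<lambda>x. ?g x * quad_form w A x)
      (\<Sum>i\<in>w. \<Sum>j\<in>w. A i j * S i j)" for A
  proof -
    have "has_bochner_integral (lebesgue_on_coords w) (\<lambda>x. \<Sum>i\<in>w. \<Sum>j\<in>w. A i j * (?g x * (x i * x j)))
      (\<Sum>i\<in>w. \<Sum>j\<in>w. A i j * S i j)"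
      by (intro has_bochner_integral_sum has_bochner_integral_mult_right moment)
    then show ?thesis
      by (simp add: quad_form_def sum_distrib_left ac_simps)
  qed
  have tr: "(\<Sum>i\<in>w. \<Sum>j\<in>w. K i j * S i j) = card w"
  proof -
    have "(\<Sum>i\<in>w. \<Sum>j\<in>w. K i j * S i j) = (\<Sum>i\<in>w. \<Sum>j\<in>w. K i j * S j i)"
      using 1 unfolding gaussian_on_def symmetric_on_def by (intro sum.cong refl) metis
    also have "\<dots> = (\<Sum>i\<in>w. 1)"
      using 1 by (intro sum.cong) (auto simp: gaussian_on_def left_inverse_on_def)
    finally show ?thesis by simp
  qed
  have ln_ratio: "log (exp 1) (?g x / gauss_density w K2 c2 x)
      = (ln c - ln c2) - quad_form w K x / 2 + quad_form w K2 x / 2" for x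
    using c by (simp add: log_def gauss_density_def ln_div ln_mult)
  have "rel_entropy (density (lebesgue_on_coords w) ?g) (density (lebesgue_on_coords w) (gauss_density w K2 c2))
      = (\<integral>x. ?g x * log (exp 1) (?g x / gauss_density w K2 c2 x) \<partial>lebesgue_on_coords w)"
    unfolding rel_entropy_def
    using gauss_density_pos[OF c(1)] gauss_density_pos[OF c(2)]
    by (intro KL_density_density) (auto simp: less_imp_le less_imp_neq[symmetric])
  also have "\<dots> = (\<integral>x. (ln c - ln c2) * ?g x - (?g x * quad_form w K x) / 2 + (?g x * quad_form w K2 x) / 2
        \<partial>lebesgue_on_coords w)"
    unfolding ln_ratio by (intro Bochner_Integration.integral_cong refl) (simp add: algebra_simps)
  also have "\<dots> = (ln c - ln c2) * 1 - (\<Sum>i\<in>w. \<Sum>j\<in>w. K i j * S i j) / 2 + (\<Sum>i\<in>w. \<Sum>j\<in>w. K2 i j * S i j) / 2"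
    by (intro has_bochner_integral_integral_eq has_bochner_integral_add has_bochner_integral_diff
        has_bochner_integral_mult_right has_bochner_integral_divide_zero quad total)
  finally show ?thesis by (simp add: tr)
qed

lemma quad_form_scaled_identity:
  "finite w \<Longrightarrow> quad_form w (scaled_identity t) x = t * (\<Sum>i\<in>w. (x i)\<^sup>2)"
  by (simp add: quad_form_def scaled_identity_def if_distrib[of "\<lambda>a. a * _"] if_distrib[of "\<lambda>a. _ * a"]
      sum_distrib_left power2_eq_square ac_simps cong: if_cong)

lemma scaled_identity_symmetric_posdef:
  assumes "0 < t" "finite w"
  shows "symmetric_on w (scaled_identity t)" "posdef_on w (scaled_identity t)"
proof -
  show "symmetric_on w (scaled_identity t)"
    by (auto simp: symmetric_on_def scaled_identity_def)
  show "posdef_on w (scaled_identity t)"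
    unfolding posdef_on_def quad_form_scaled_identity[OF assms(2)]
  proof (intro allI impI mult_pos_pos assms)
    fix x :: "nat \<Rightarrow> real" assume "\<exists>i\<in>w. x i \<noteq> 0"
    then obtain i where "i \<in> w" "x i \<noteq> 0" by auto
    then show "0 < (\<Sum>i\<in>w. (x i)\<^sup>2)"
      using assms(2) by (intro sum_pos2[of _ i]) auto
  qed
qed

text \<open>Here \<open>ln c - ln c2\<close> stands for minus half the log-determinant of
  \<open>S\<close> divided by \<open>t\<close>. The normalizers are kept because adding a coordinate
  changes them by an explicit factor.\<close>

lemma rel_entropy_scaled_identity:
  assumes "0 < t" "gaussian_on w S K c" "gaussian_on w (scaled_identity t) K2 c2"
  shows "rel_entropy (density (lebesgue_on_coords w) (gauss_density w K c))
      (density (lebesgue_on_coords w) (gauss_density w K2 c2))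
    = ln c - ln c2 - card w / 2 + (\<Sum>i\<in>w. S i i) / (2 * t)"
proof -
  have fin: "finite w" using assms by (simp add: gaussian_on_def)
  have inv: "left_inverse_on w (scaled_identity (1 / t)) (scaled_identity t)"
    using assms(1) fin unfolding left_inverse_on_def scaled_identity_def
    by (auto simp: if_distrib[of "\<lambda>a. a * _"] if_distrib[of "\<lambda>a. _ * a"] cong: if_cong)
  have "K2 i j = scaled_identity (1 / t) i j" if "i \<in> w" "j \<in> w" for i j
    using assms(3) that inv fin unfolding gaussian_on_def
    by (intro left_inverse_on_unique[symmetric, OF fin inv]) auto
  then have "(\<Sum>i\<in>w. \<Sum>j\<in>w. K2 i j * S i j) = (\<Sum>i\<in>w. \<Sum>j\<in>w. scaled_identity (1 / t) i j * S i j)"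
    by (intro sum.cong) auto
  also have "\<dots> = (\<Sum>i\<in>w. S i i) / t"
    using fin by (simp add: scaled_identity_def if_distrib[of "\<lambda>a. a * _"] sum_divide_distrib cong: if_cong)
  finally show ?thesis
    unfolding rel_entropy_gaussian[OF assms(2,3)] by simp
qed

section \<open>Determinants and the explicit Gaussian law\<close>

text \<open>Multiplication by the unitriangular \<open>E\<close> subtracts from the last column the
  combination \<open>\<beta>\<close> of the others. By the normal equations only its bottom entry
  survives, and Laplace expansion along this column leaves the smaller determinant.\<close>

lemma det_extension:
  fixes S :: "nat \<Rightarrow> nat \<Rightarrow> real"
  assumes eq: "\<And>i. i < m \<Longrightarrow> (\<Sum>l<m. S i l * \<beta> l) = S i m"
  shows "Determinant.det (Matrix.mat (Suc m) (Suc m) (\<lambda>(i, j). S i j)) =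
    (S m m - (\<Sum>l<m. S m l * \<beta> l)) * Determinant.det (Matrix.mat m m (\<lambda>(i, j). S i j))"
proof -
  define A where "A = Matrix.mat (Suc m) (Suc m) (\<lambda>(i, j). S i j)"
  define E where "E = Matrix.mat (Suc m) (Suc m)
    (\<lambda>(i, j). if j = m \<and> i < m then - \<beta> i else if i = j then 1 else 0)"
  have carrier: "A \<in> carrier_mat (Suc m) (Suc m)" "E \<in> carrier_mat (Suc m) (Suc m)"
    by (auto simp: A_def E_def)
  have "Determinant.det E = prod_list (diag_mat E)"
    using carrier by (intro det_upper_triangular) (auto simp: E_def upper_triangular_def)
  also have "\<dots> = 1"
    by (auto simp: E_def prod_list_diag_prod)
  finally have "Determinant.det (A * E) = Determinant.det A"
    using det_mult[OF carrier] by simp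
  have AE: "(A * E) $$ (i, j) = (if j < m then S i j else S i m - (\<Sum>l<m. S i l * \<beta> l))"
    if "i < Suc m" "j < Suc m" for i j
  proof -
    have "(A * E) $$ (i, j) = (\<Sum>l<Suc m. S i l * E $$ (l, j))"
      using that by (simp add: A_def E_def scalar_prod_def atLeast0LessThan)
    also have "\<dots> = (\<Sum>l<m. S i l * E $$ (l, j)) + S i m * E $$ (m, j)" by simp
    also have "\<dots> = (if j < m then S i j else S i m - (\<Sum>l<m. S i l * \<beta> l))"
    proof (cases "j < m")
      case True
      have "(\<Sum>l<m. S i l * E $$ (l, j)) = (\<Sum>l<m. if l = j then S i l else 0)"
        using True by (intro sum.cong) (auto simp: E_def)
      then show ?thesis using True by (simp add: E_def)
    next
      case False
      then have "j = m" using that by simp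
      then show ?thesis by (simp add: E_def sum_negf)
    qed
    finally show ?thesis .
  qed
  have "Determinant.det (A * E) = (\<Sum>i<Suc m. (A * E) $$ (i, m) * cofactor (A * E) i m)"
    using carrier by (intro laplace_expansion_column) auto
  also have "\<dots> = (S m m - (\<Sum>l<m. S m l * \<beta> l)) * cofactor (A * E) m m"
    by (simp add: AE eq)
  also have "cofactor (A * E) m m = Determinant.det (mat_delete (A * E) m m)"
    by (simp add: cofactor_def)
  also have "mat_delete (A * E) m m = Matrix.mat m m (\<lambda>(i, j). S i j)"
    using carrier AE by (intro eq_matI) (auto simp: mat_delete_def)
  finally show ?thesis
    using \<open>Determinant.det (A * E) = Determinant.det A\<close> by (simp add: A_def)
qed

text \<open>With each new coordinate the normalizer is divided by \<open>sqrt (2 * pi * p)\<close>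
  and the determinant multiplied by the same residual variance \<open>p\<close>. This ties the
  abstract \<open>c\<close> to the formula in \<open>gaussian_law\<close>.\<close>

lemma gaussian_normalizer_det:
  assumes "symmetric_on {..<m} S" "posdef_on {..<m} S" "gaussian_on {..<m} S K c"
  shows "0 < Determinant.det (Matrix.mat m m (\<lambda>(i, j). S i j)) \<and>
    c = 1 / sqrt ((2 * pi) ^ m * Determinant.det (Matrix.mat m m (\<lambda>(i, j). S i j)))"
  using assms
proof (induction m arbitrary: K c)
  case 0
  have "Determinant.det (Matrix.mat 0 0 (\<lambda>(i, j). S i j)) = 1"
    by (intro det_dim_zero) auto
  then show ?case using gaussian_on_unique(1)[OF _ gaussian_on_empty, of S K c] 0 by simp
next
  case (Suc m)
  have sub: "{..<m} \<subseteq> {..<Suc m}" and ins: "{..<Suc m} = insert m {..<m}" by auto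
  have u: "symmetric_on {..<m} S" "posdef_on {..<m} S"
    using symmetric_on_subset[OF Suc.prems(1) sub] posdef_on_subset[OF Suc.prems(2) _ sub] by auto
  then obtain K0 c0 where 0: "gaussian_on {..<m} S K0 c0"
    using gaussian_on_exists[of "{..<m}" S] finite_lessThan by blast
  interpret gaussian_extension "{..<m}" S K0 c0 m "regression_coeff {..<m} S K0 m" "residual_var {..<m} S K0 m"
    using 0 Suc.prems(1,2) unfolding ins by unfold_locales auto
  have c: "c = c0 / sqrt (2 * pi * residual_var {..<m} S K0 m)"
    using gaussian_on_unique(1)[OF Suc.prems(3)] gaussian_on_extension unfolding ins by auto
  have "(\<Sum>l<m. S m l * regression_coeff {..<m} S K0 m l) = (\<Sum>l<m. regression_coeff {..<m} S K0 m l * S l m)"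
    by (intro sum.cong) (auto simp: symj)
  then have d: "Determinant.det (Matrix.mat (Suc m) (Suc m) (\<lambda>(i, j). S i j)) =
      residual_var {..<m} S K0 m * Determinant.det (Matrix.mat m m (\<lambda>(i, j). S i j))"
    using det_extension[of m S "regression_coeff {..<m} S K0 m"] normal_equation p_eq by simp
  show ?case
    unfolding d c using Suc.IH[OF u 0] p_pos by (auto simp: real_sqrt_mult field_simps)
qed

text \<open>The determinant is positive, hence \<open>mat_inverse\<close> succeeds and
  \<open>the\<close> returns a genuine inverse; uniqueness of the inverse identifies it with
  \<open>K\<close>.\<close>

lemma gaussian_law_gaussian_on:
  assumes A: "A \<in> carrier_mat n n" and S: "\<And>i j. i < n \<Longrightarrow> j < n \<Longrightarrow> A $$ (i, j) = S i j"
    and "symmetric_on {..<n} S" "posdef_on {..<n} S"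
  shows "\<exists>K c. gaussian_on {..<n} S K c \<and>
    gaussian_law A = density (lebesgue_on_coords {..<n}) (gauss_density {..<n} K c)"
proof -
  obtain K c where 1: "gaussian_on {..<n} S K c"
    using gaussian_on_exists[of "{..<n}" S] assms by auto
  have AS: "A = Matrix.mat n n (\<lambda>(i, j). S i j)" using A by (intro eq_matI) (auto simp: S)
  have c: "0 < Determinant.det A" "c = 1 / sqrt ((2 * pi) ^ n * Determinant.det A)"
    using gaussian_normalizer_det[OF assms(3,4) 1] AS by auto
  obtain B where B: "mat_inverse A = Some B"
    using mat_inverse(1)[OF A, of _] det_non_zero_imp_unit[OF A, of _] c(1) by (cases "mat_inverse A") fastforce+
  then have BA: "B * A = 1\<^sub>m n" "B \<in> carrier_mat n n" using mat_inverse(2)[OF A] by auto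
  have "left_inverse_on {..<n} (\<lambda>i j. B $$ (i, j)) S"
    unfolding left_inverse_on_def
  proof (intro ballI)
    fix i j assume "i \<in> {..<n}" "j \<in> {..<n}"
    then have ij: "i < n" "j < n" by auto
    have "(\<Sum>l<n. B $$ (i, l) * S l j) = (B * A) $$ (i, j)"
      using ij A BA(2) by (simp add: S scalar_prod_def atLeast0LessThan)
    then show "(\<Sum>l<n. B $$ (i, l) * S l j) = (if i = j then 1 else 0)"
      using ij by (simp add: BA(1))
  qed
  then have "B $$ (i, j) = K i j" if "i < n" "j < n" for i j
    using 1 that unfolding gaussian_on_def
    by (intro left_inverse_on_unique[of "{..<n}" "\<lambda>i j. B $$ (i, j)"]) auto
  then have q: "(\<Sum>i<n. \<Sum>j<n. x i * B $$ (i, j) * x j) = quad_form {..<n} K x" for x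
    unfolding quad_form_def by (intro sum.cong) auto
  have "gaussian_law A = density (lebesgue_on_coords {..<n}) (gauss_density {..<n} K c)"
    using A unfolding gaussian_law_def Let_def B c(2) gauss_density_def by (simp add: q)
  then show ?thesis using 1 by blast
qed

lemma marginal_gaussian_law:
  assumes "A \<in> carrier_mat n n" "\<And>i j. i < n \<Longrightarrow> j < n \<Longrightarrow> A $$ (i, j) = S i j"
    and "symmetric_on {..<n} S" "posdef_on {..<n} S" and v: "v \<subseteq> {..<n}"
  shows "\<exists>K c. gaussian_on v S K c \<and>
    marginal v (gaussian_law A) = density (lebesgue_on_coords v) (gauss_density v K c)"
proof -
  obtain K c where 1: "gaussian_on {..<n} S K c"
    "gaussian_law A = density (lebesgue_on_coords {..<n}) (gauss_density {..<n} K c)"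
    using gaussian_law_gaussian_on[OF assms(1-4)] by blast
  \<comment> \<open>\<open>marginal\<close> has products of \<open>borel\<close> as target and
    \<open>lborel\<close> appears here; only the sigma-algebra of the target matters, and it is the
    same.\<close>
  have "marginal v (gaussian_law A) = distr (gaussian_law A) (lebesgue_on_coords v) (\<lambda>x. restrict x v)"
    unfolding marginal_def by (intro distr_cong sets_PiM_cong) auto
  then show ?thesis unfolding 1(2) using gaussian_marginal[OF 1(1) assms(4) v] by simp
qed

subsection \<open>Relative entropy and the Frobenius norm\<close>

text \<open>In the application \<open>p + q - 1\<close> is the new diagonal entry of
  \<open>M\<close> and \<open>B\<close> the squared norm of the new off-diagonal column. On
  \<open>[1/4, 2]\<close> the term \<open>p - 1 - ln p\<close> is comparable to
  \<open>(p - 1)\<^sup>2\<close>, and replacing \<open>p\<close> by \<open>p + q\<close> in the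
  square costs a multiple of \<open>q\<^sup>2 \<le> 2 * q\<close>. The constants 34 and 32 are
  generous.\<close>

lemma entropy_increment_bounds:
  fixes p q B :: real
  assumes p: "1 / 4 \<le> p" "p \<le> 2" and q: "0 \<le> q" "p + q \<le> 2" and B: "B / 2 \<le> q" "q \<le> 4 * B"
  shows "(p + q - 1 - ln p) / 2 \<le> 34 * ((p + q - 1)\<^sup>2 + 2 * B)"
    and "(p + q - 1)\<^sup>2 + 2 * B \<le> 32 * ((p + q - 1 - ln p) / 2)"
proof -
  have p0: "0 < p" using p by simp
  have qq: "q\<^sup>2 \<le> 2 * q" using q p0 unfolding power2_eq_square by (intro mult_right_mono) auto
  have "ln (1 / p) \<le> 1 / p - 1" using p0 by (intro ln_le_minus_one) auto
  then have "p - 1 - ln p \<le> p - 2 + 1 / p" using p0 by (simp add: ln_div)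
  also have "\<dots> = (p - 1)\<^sup>2 / p" using p0 by (simp add: field_simps power2_eq_square)
  also have "\<dots> \<le> (p - 1)\<^sup>2 / (1 / 4)" using p by (intro divide_left_mono) auto
  finally have up: "p - 1 - ln p \<le> 4 * (p - 1)\<^sup>2" by simp
  have "(p - 1)\<^sup>2 \<le> 2 * (p + q - 1)\<^sup>2 + 2 * q\<^sup>2"
    using zero_le_power2[of "(p + q - 1) + q"] by (simp add: power2_eq_square algebra_simps)
  then have "p + q - 1 - ln p \<le> 8 * (p + q - 1)\<^sup>2 + 17 * q"
    using up qq by linarith
  then show "(p + q - 1 - ln p) / 2 \<le> 34 * ((p + q - 1)\<^sup>2 + 2 * B)"
    using B q zero_le_power2[of "p + q - 1"] by argo
  \<comment> \<open>Applying \<open>ln y \<le> y - 1\<close> to the square root is sharper than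
    applying it to \<open>p\<close>: it leaves the square \<open>(sqrt p - 1)\<^sup>2\<close> as a
    lower bound.\<close>
  have "ln p = 2 * ln (sqrt p)" using p0 by (simp add: ln_sqrt)
  also have "\<dots> \<le> 2 * (sqrt p - 1)" using ln_le_minus_one[of "sqrt p"] p0 by simp
  finally have "(sqrt p - 1)\<^sup>2 \<le> p - 1 - ln p"
    using p0 by (simp add: power2_eq_square algebra_simps)
  moreover have "(p - 1)\<^sup>2 \<le> 6 * (sqrt p - 1)\<^sup>2"
  proof -
    have "(p - 1)\<^sup>2 = (sqrt p + 1)\<^sup>2 * (sqrt p - 1)\<^sup>2"
      using p0 by (simp flip: power_mult_distrib add: algebra_simps)
    \<comment> \<open>1.42 exceeds the square root of 2, the largest possible value, and 2.42
      squared is still below 6.\<close>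
    moreover have "sqrt p \<le> 142 / 100"
      using p by (intro real_le_lsqrt) (auto simp: power2_eq_square)
    then have "(sqrt p + 1)\<^sup>2 \<le> (242 / 100)\<^sup>2"
      using p0 by (intro power_mono) auto
    then have "(sqrt p + 1)\<^sup>2 \<le> 6" by (simp add: power2_eq_square)
    ultimately show ?thesis by (simp add: mult_right_mono)
  qed
  moreover have "a \<le> b \<Longrightarrow> c \<le> 6 * a \<Longrightarrow> c \<le> 6 * b" for a b c :: real by linarith
  ultimately have low: "(p - 1)\<^sup>2 \<le> 6 * (p - 1 - ln p)" by blast
  have "(p + q - 1)\<^sup>2 \<le> 2 * (p - 1)\<^sup>2 + 2 * q\<^sup>2"
    using zero_le_power2[of "(p - 1) - q"] by (simp add: power2_eq_square algebra_simps)
  moreover have "0 \<le> p - 1 - ln p" using ln_le_minus_one[OF p0] by simp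
  ultimately show "(p + q - 1)\<^sup>2 + 2 * B \<le> 32 * ((p + q - 1 - ln p) / 2)"
    using low qq B q by argo
qed

lemma quad_form_diff_scaled:
  assumes "symmetric_on u S"
  shows "quad_form u S (\<lambda>i. x i - t * y i) =
    quad_form u S x - 2 * t * (\<Sum>i\<in>u. y i * (\<Sum>l\<in>u. S i l * x l)) + t\<^sup>2 * quad_form u S y"
proof -
  have sw: "(\<Sum>i\<in>u. \<Sum>l\<in>u. x i * S i l * y l) = (\<Sum>i\<in>u. \<Sum>l\<in>u. y i * S i l * x l)"
    using assms unfolding symmetric_on_def
    by (subst sum.swap, intro sum.cong refl) (metis mult.commute mult.left_commute)
  have "quad_form u S (\<lambda>i. x i - t * y i) = (\<Sum>i\<in>u. \<Sum>l\<in>u. x i * S i l * x l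
      - t * (x i * S i l * y l) - t * (y i * S i l * x l) + t\<^sup>2 * (y i * S i l * y l))"
    unfolding quad_form_def by (intro sum.cong refl) (simp add: algebra_simps power2_eq_square)
  also have "\<dots> = quad_form u S x - t * (\<Sum>i\<in>u. \<Sum>l\<in>u. x i * S i l * y l)
      - t * (\<Sum>i\<in>u. \<Sum>l\<in>u. y i * S i l * x l) + t\<^sup>2 * quad_form u S y"
    by (simp add: quad_form_def sum.distrib sum_subtractf sum_distrib_left)
  also have "\<dots> = quad_form u S x - 2 * t * (\<Sum>i\<in>u. y i * (\<Sum>l\<in>u. S i l * x l)) + t\<^sup>2 * quad_form u S y"
    unfolding sw by (simp add: sum_distrib_left sum_negf mult.assoc)
  finally show ?thesis .
qed

text \<open>The bounds on the spectrum of \<open>S / t\<close> are stated through the quadratic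
  form, so that they pass to principal submatrices by padding vectors with zeros, without eigenvalue
  interlacing.\<close>

definition form_bounds :: "nat set \<Rightarrow> real \<Rightarrow> (nat \<Rightarrow> nat \<Rightarrow> real) \<Rightarrow> bool" where
  "form_bounds w t S \<longleftrightarrow> (\<forall>x. t / 4 * (\<Sum>i\<in>w. (x i)\<^sup>2) \<le> quad_form w S x \<and>
     quad_form w S x \<le> 2 * t * (\<Sum>i\<in>w. (x i)\<^sup>2))"

lemma form_bounds_subset:
  assumes "form_bounds w t S" "finite w" "u \<subseteq> w"
  shows "form_bounds u t S"
  unfolding form_bounds_def
proof
  fix x :: "nat \<Rightarrow> real"
  have "(\<Sum>i\<in>w. (if i \<in> u then x i else 0)\<^sup>2) = (\<Sum>i\<in>u. (if i \<in> u then x i else 0)\<^sup>2)"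
    using assms by (intro sum.mono_neutral_right) auto
  also have "\<dots> = (\<Sum>i\<in>u. (x i)\<^sup>2)" by (intro sum.cong) auto
  finally show "t / 4 * (\<Sum>i\<in>u. (x i)\<^sup>2) \<le> quad_form u S x \<and> quad_form u S x \<le> 2 * t * (\<Sum>i\<in>u. (x i)\<^sup>2)"
    using assms(1)[unfolded form_bounds_def, rule_format, of "\<lambda>i. if i \<in> u then x i else 0"]
    by (simp add: quad_form_zero_extension[OF assms(2,3)])
qed

lemma form_bounds_posdef:
  assumes "form_bounds w t S" "0 < t" "finite w"
  shows "posdef_on w S"
  unfolding posdef_on_def
proof (intro allI impI)
  fix x :: "nat \<Rightarrow> real" assume "\<exists>i\<in>w. x i \<noteq> 0"
  then obtain i where "i \<in> w" "x i \<noteq> 0" by auto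
  then have "0 < t / 4 * (\<Sum>i\<in>w. (x i)\<^sup>2)"
    using assms by (intro mult_pos_pos sum_pos2[of _ i]) auto
  then show "0 < quad_form w S x"
    using assms(1) unfolding form_bounds_def by (meson less_le_trans)
qed

text \<open>Under adding a coordinate both quantities grow by exactly the two sides of
  \<open>entropy_increment_bounds\<close>, so the scalar estimates add up. The given normalizers are
  arbitrary, hence the appeals to uniqueness.\<close>

lemma entropy_frobenius_bounds:
  assumes t: "0 < t" and "finite w" and "symmetric_on w S" and "form_bounds w t S"
    and "gaussian_on w S K c" and "gaussian_on w (scaled_identity t) K2 c2"
  shows "ln c - ln c2 - card w / 2 + (\<Sum>i\<in>w. S i i) / (2 * t)
      \<le> 34 * (\<Sum>i\<in>w. \<Sum>l\<in>w. (S i l / t - scaled_identity 1 i l)\<^sup>2)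
    \<and> (\<Sum>i\<in>w. \<Sum>l\<in>w. (S i l / t - scaled_identity 1 i l)\<^sup>2)
      \<le> 32 * (ln c - ln c2 - card w / 2 + (\<Sum>i\<in>w. S i i) / (2 * t))"
proof -
  define V where "V w c c2 = ln c - ln c2 - card w / 2 + (\<Sum>i\<in>w. S i i) / (2 * t)" for w :: "nat set" and c c2
  define F where "F w = (\<Sum>i\<in>w. \<Sum>l\<in>w. (S i l / t - scaled_identity 1 i l)\<^sup>2)" for w
  have "V w c c2 \<le> 34 * F w \<and> F w \<le> 32 * V w c c2"
    using assms(2-6)
  proof (induction w arbitrary: K c K2 c2)
    case empty
    have "c = 1" "c2 = 1"
      using gaussian_on_unique(1)[OF _ gaussian_on_empty] empty by blast+
    then show ?case by (simp add: V_def F_def)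
  next
    case (insert j u)
    let ?w = "insert j u"
    have fin: "finite ?w" "u \<subseteq> ?w" using insert by auto
    have u: "symmetric_on u S" "form_bounds u t S" "posdef_on u S" "posdef_on ?w S"
      using symmetric_on_subset form_bounds_subset form_bounds_posdef insert.prems insert.hyps t fin by blast+
    obtain K0 c0 where 0: "gaussian_on u S K0 c0"
      using gaussian_on_exists[of u S] u insert.hyps(1) by blast
    obtain K1 c1 where 1: "gaussian_on u (scaled_identity t) K1 c1"
      using gaussian_on_exists[of u "scaled_identity t"] scaled_identity_symmetric_posdef[OF t insert.hyps(1)]
        insert.hyps(1) by blast
    note IH = insert.IH[OF u(1,2) 0 1]
    define \<beta> where "\<beta> = regression_coeff u S K0 j"
    define p where "p = residual_var u S K0 j"
    interpret G: gaussian_extension u S K0 c0 j \<beta> p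
      using 0 insert u unfolding \<beta>_def p_def by unfold_locales auto
    interpret I: gaussian_extension u "scaled_identity t" K1 c1 j
      "regression_coeff u (scaled_identity t) K1 j" "residual_var u (scaled_identity t) K1 j"
      using 1 insert scaled_identity_symmetric_posdef[OF t fin(1)] by unfold_locales auto
    have sid: "l \<in> u \<Longrightarrow> scaled_identity a l j = 0" "l \<in> u \<Longrightarrow> scaled_identity a j l = 0"
      "scaled_identity a j j = a" for l a
      using insert.hyps by (auto simp: scaled_identity_def)
    \<comment> \<open>Under the reference law the coordinates are uncorrelated: nothing is explained
      by \<open>u\<close>, and all of \<open>t\<close> remains.\<close>
    have pI: "residual_var u (scaled_identity t) K1 j = t"
      by (simp add: residual_var_def sid)
    have c: "c = c0 / sqrt (2 * pi * p)"
      using gaussian_on_unique(1)[OF insert.prems(3) G.gaussian_on_extension] .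
    have c2: "c2 = c1 / sqrt (2 * pi * t)"
      using gaussian_on_unique(1)[OF insert.prems(4) I.gaussian_on_extension] pI by simp
    define q where "q = (\<Sum>l\<in>u. \<beta> l * S l j)"
    define b where "b = (\<lambda>l. S l j / t)"
    define B where "B = (\<Sum>l\<in>u. (b l)\<^sup>2)"
    have bnd: "t / 4 * (\<Sum>i\<in>u. (x i)\<^sup>2) \<le> quad_form u S x" "quad_form u S x \<le> 2 * t * (\<Sum>i\<in>u. (x i)\<^sup>2)" for x
      using u(2) unfolding form_bounds_def by auto
    have bndw: "t / 4 * (\<Sum>i\<in>?w. (x i)\<^sup>2) \<le> quad_form ?w S x" "quad_form ?w S x \<le> 2 * t * (\<Sum>i\<in>?w. (x i)\<^sup>2)" for x
      using insert.prems(2) unfolding form_bounds_def by auto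
    have q_eq: "q = quad_form u S \<beta>" by (simp add: q_def G.quad_form_beta)
    have q0: "0 \<le> q"
      using bnd(1)[of \<beta>] t sum_nonneg[of u "\<lambda>i. (\<beta> i)\<^sup>2"] unfolding q_eq
      by (smt (verit) divide_pos_pos mult_nonneg_nonneg zero_le_power2)
    have pq: "p + q = S j j" using G.p_eq by (simp add: q_def)
    have Sjj: "S j j \<le> 2 * t"
      using bndw(2)[of "\<lambda>i. if i \<in> {j} then 1 else 0"] quad_form_zero_extension[OF fin(1), of "{j}" S "\<lambda>_. 1"]
        insert.hyps by (simp add: quad_form_def if_distrib[of "\<lambda>a. a\<^sup>2"] cong: if_cong)
    have p_low: "t / 4 \<le> p"
    proof -
      have "t / 4 * 1 \<le> t / 4 * (\<Sum>i\<in>?w. ((\<beta>(j := -1)) i)\<^sup>2)"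
        using t insert.hyps by (intro mult_left_mono) (auto intro: sum_nonneg)
      then show ?thesis using bndw(1)[of "\<beta>(j := -1)"] G.p_eq_quad_form by simp
    qed
    have b: "(\<Sum>l\<in>u. S i l * \<beta> l) = t * b i" if "i \<in> u" for i
      using G.normal_equation[OF that] t by (simp add: b_def)
    \<comment> \<open>Since \<open>S\<close> maps \<open>\<beta>\<close> to \<open>t * b\<close>,
      the form at \<open>\<beta> - b / 2\<close> equals
      \<open>q - t * B + quad_form u S b / 4\<close>. It is nonnegative, and the upper form bound
      makes its last term at most \<open>t * B / 2\<close>.\<close>
    have B_low: "t * B / 2 \<le> q"
    proof -
      have "0 \<le> quad_form u S (\<lambda>i. \<beta> i - 1 / 2 * b i)"
        using bnd(1)[of "\<lambda>i. \<beta> i - 1 / 2 * b i"] t sum_nonneg[of u "\<lambda>i. (\<beta> i - 1 / 2 * b i)\<^sup>2"]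
        by (smt (verit) divide_pos_pos mult_nonneg_nonneg zero_le_power2)
      also have "\<dots> = q - (\<Sum>i\<in>u. b i * (t * b i)) + quad_form u S b / 4"
        unfolding quad_form_diff_scaled[OF u(1)] q_eq by (simp add: b power2_eq_square cong: sum.cong)
      also have "(\<Sum>i\<in>u. b i * (t * b i)) = t * B"
        by (simp add: B_def sum_distrib_left power2_eq_square ac_simps)
      finally show ?thesis using bnd(2)[of b] by (simp add: B_def)
    qed
    \<comment> \<open>Young's inequality with weights 1/8 and 2, chosen so that the lower form bound
      absorbs the \<open>\<beta>\<close> part into \<open>q / 2\<close>.\<close>
    have B_up: "q \<le> 4 * t * B"
    proof -
      have "q = (\<Sum>l\<in>u. t * (\<beta> l * b l))" using t by (simp add: q_def b_def)
      also have "\<dots> \<le> (\<Sum>l\<in>u. t * ((\<beta> l)\<^sup>2 / 8 + 2 * (b l)\<^sup>2))"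
      proof (intro sum_mono mult_left_mono)
        fix l
        show "\<beta> l * b l \<le> (\<beta> l)\<^sup>2 / 8 + 2 * (b l)\<^sup>2"
          using zero_le_power2[of "\<beta> l - 4 * b l"] by (simp add: power2_eq_square algebra_simps)
      qed (use t in auto)
      also have "\<dots> = t / 4 * (\<Sum>l\<in>u. (\<beta> l)\<^sup>2) / 2 + 2 * t * B"
        by (simp add: B_def sum.distrib distrib_left sum_distrib_left sum_divide_distrib ac_simps)
      also have "\<dots> \<le> q / 2 + 2 * t * B" using bnd(1)[of \<beta>] unfolding q_eq by simp
      finally show ?thesis by simp
    qed
    define p' q' where "p' = p / t" and "q' = q / t"
    have pq': "p' + q' = S j j / t" using pq by (simp add: p'_def q'_def add_divide_distrib[symmetric])
    have inc: "(p' + q' - 1 - ln p') / 2 \<le> 34 * ((p' + q' - 1)\<^sup>2 + 2 * B)"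
      "(p' + q' - 1)\<^sup>2 + 2 * B \<le> 32 * ((p' + q' - 1 - ln p') / 2)"
    proof -
      have "1 / 4 \<le> p'" "0 \<le> q'" "p' + q' \<le> 2" "B / 2 \<le> q'" "q' \<le> 4 * B"
        using p_low q0 Sjj B_low B_up t unfolding pq' by (auto simp: p'_def q'_def field_simps)
      then show "(p' + q' - 1 - ln p') / 2 \<le> 34 * ((p' + q' - 1)\<^sup>2 + 2 * B)"
        "(p' + q' - 1)\<^sup>2 + 2 * B \<le> 32 * ((p' + q' - 1 - ln p') / 2)"
        using entropy_increment_bounds[of p' q' B] by auto
    qed
    \<comment> \<open>The new row and the new column contribute \<open>B\<close> each, by symmetry
      of \<open>S\<close>.\<close>
    have F: "F ?w = F u + ((p' + q' - 1)\<^sup>2 + 2 * B)"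
    proof -
      have "F ?w = (S j j / t - 1)\<^sup>2 + (\<Sum>l\<in>u. (S j l / t)\<^sup>2) + ((\<Sum>i\<in>u. (S i j / t)\<^sup>2) + F u)"
        using insert.hyps by (simp add: F_def sid sum.distrib)
      also have "(\<Sum>l\<in>u. (S j l / t)\<^sup>2) = B"
        unfolding B_def b_def by (intro sum.cong) (auto simp: G.symj)
      finally show ?thesis by (simp add: pq' B_def b_def)
    qed
    have c01: "0 < c0" "0 < c1" "0 < p" using G.c_pos I.c_pos G.p_pos by auto
    have lnc: "ln c - ln c2 = ln c0 - ln c1 - ln p' / 2"
      using c01 t unfolding c c2 p'_def by (simp add: ln_div ln_mult ln_sqrt field_simps)
    have V: "V ?w c c2 = V u c0 c1 + (p' + q' - 1 - ln p') / 2"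
      using insert.hyps t by (simp add: V_def lnc pq' field_simps)
    show ?case using IH inc unfolding F V by (simp add: distrib_left add_mono)
  qed
  then show ?thesis by (simp add: V_def F_def)
qed

section \<open>Averaging over subsets of fixed size\<close>

lemma card_subsets_containing:
  assumes "finite A" "B \<subseteq> A" "card B \<le> k"
  shows "card {v. v \<subseteq> A \<and> card v = k \<and> B \<subseteq> v} = (card A - card B) choose (k - card B)"
proof -
  have finB: "finite B" using assms finite_subset by blast
  have bij: "bij_betw (\<lambda>u. u \<union> B) {u. u \<subseteq> A - B \<and> card u = k - card B} {v. v \<subseteq> A \<and> card v = k \<and> B \<subseteq> v}"
  proof (rule bij_betwI[where g = "\<lambda>v. v - B"])
    show "(\<lambda>u. u \<union> B) \<in> {u. u \<subseteq> A - B \<and> card u = k - card B} \<rightarrow> {v. v \<subseteq> A \<and> card v = k \<and> B \<subseteq> v}"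
    proof
      fix u assume u: "u \<in> {u. u \<subseteq> A - B \<and> card u = k - card B}"
      then have "finite u" using assms finite_subset by auto
      then have "card (u \<union> B) = card u + card B"
        using finB u by (intro card_Un_disjoint) auto
      then show "u \<union> B \<in> {v. v \<subseteq> A \<and> card v = k \<and> B \<subseteq> v}" using u assms by auto
    qed
    show "(\<lambda>v. v - B) \<in> {v. v \<subseteq> A \<and> card v = k \<and> B \<subseteq> v} \<rightarrow> {u. u \<subseteq> A - B \<and> card u = k - card B}"
      using finB by (auto simp: card_Diff_subset)
  qed auto
  have "card {v. v \<subseteq> A \<and> card v = k \<and> B \<subseteq> v} = card {u. u \<subseteq> A - B \<and> card u = k - card B}"
    by (rule bij_betw_same_card[OF bij, symmetric])
  also have "\<dots> = (card A - card B) choose (k - card B)"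
    using assms finB by (simp add: n_subsets card_Diff_subset)
  finally show ?thesis .
qed

text \<open>A uniformly random \<open>k\<close>-subset contains a given pair of distinct indices
  with probability \<open>k (k - 1) / (n (n - 1))\<close> and a given index with probability
  \<open>k / n\<close>. The second term of the formula is the excess of the latter over the former,
  which occurs on the diagonal only.\<close>

lemma average_over_subsets:
  fixes a :: "nat \<Rightarrow> nat \<Rightarrow> real"
  assumes n: "2 \<le> n" and k: "1 \<le> k" "k \<le> n"
  shows "(\<Sum>v | v \<subseteq> {..<n} \<and> card v = k. \<Sum>i\<in>v. \<Sum>j\<in>v. a i j) / (n choose k) =
    real k * (real k - 1) / (real n * (real n - 1)) * (\<Sum>i<n. \<Sum>j<n. a i j)
    + real k * (real n - real k) / (real n * (real n - 1)) * (\<Sum>i<n. a i i)"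
proof -
  let ?V = "{v. v \<subseteq> {..<n} \<and> card v = k}"
  have finV: "finite ?V" by (rule finite_subset[of _ "Pow {..<n}"]) auto
  define N where "N i j = card {v. v \<subseteq> {..<n} \<and> card v = k \<and> {i, j} \<subseteq> v}" for i j
  have ch: "0 < n choose k" using k by (simp add: zero_less_binomial)
  have "(\<Sum>v\<in>?V. \<Sum>i\<in>v. \<Sum>j\<in>v. a i j) = (\<Sum>v\<in>?V. \<Sum>i<n. \<Sum>j<n. if {i, j} \<subseteq> v then a i j else 0)"
  proof (rule sum.cong[OF refl])
    fix v assume v: "v \<in> ?V"
    have "(\<Sum>i\<in>v. \<Sum>j\<in>v. a i j) = (\<Sum>i\<in>v. \<Sum>j<n. if {i, j} \<subseteq> v then a i j else 0)"
      using v by (intro sum.cong[OF refl] sum.mono_neutral_cong_left) auto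
    also have "\<dots> = (\<Sum>i<n. \<Sum>j<n. if {i, j} \<subseteq> v then a i j else 0)"
      using v by (intro sum.mono_neutral_left) auto
    finally show "(\<Sum>i\<in>v. \<Sum>j\<in>v. a i j) = (\<Sum>i<n. \<Sum>j<n. if {i, j} \<subseteq> v then a i j else 0)" .
  qed
  also have "\<dots> = (\<Sum>i<n. \<Sum>v\<in>?V. \<Sum>j<n. if {i, j} \<subseteq> v then a i j else 0)"
    by (rule sum.swap)
  also have "\<dots> = (\<Sum>i<n. \<Sum>j<n. \<Sum>v\<in>?V. if {i, j} \<subseteq> v then a i j else 0)"
    by (rule sum.cong[OF refl], rule sum.swap)
  also have "\<dots> = (\<Sum>i<n. \<Sum>j<n. N i j * a i j)"
  proof (intro sum.cong refl)
    fix i j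
    have "(\<Sum>v\<in>?V. if {i, j} \<subseteq> v then a i j else 0) = (\<Sum>v\<in>?V \<inter> {v. {i, j} \<subseteq> v}. a i j)"
      using sum.inter_restrict[OF finV, of "\<lambda>_. a i j" "{v. {i, j} \<subseteq> v}"] by simp
    also have "?V \<inter> {v. {i, j} \<subseteq> v} = {v. v \<subseteq> {..<n} \<and> card v = k \<and> {i, j} \<subseteq> v}" by auto
    finally show "(\<Sum>v\<in>?V. if {i, j} \<subseteq> v then a i j else 0) = N i j * a i j" by (simp add: N_def)
  qed
  finally have 1: "(\<Sum>v\<in>?V. \<Sum>i\<in>v. \<Sum>j\<in>v. a i j) / (n choose k)
      = (\<Sum>i<n. \<Sum>j<n. N i j / (n choose k) * a i j)"
    by (simp add: sum_divide_distrib)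
  obtain n' where n': "n = Suc (Suc n')" using n by (cases n; cases "n - 1") auto
  obtain k' where k': "k = Suc k'" using k by (cases k) auto
  have absorb: "real n * real ((n - 1) choose k') = real k * real (n choose k)"
    using Suc_times_binomial_eq[of "Suc n'" k'] unfolding of_nat_mult[symmetric] of_nat_eq_iff n' k'
    by (simp only: diff_Suc_1 mult.commute)
  have diag: "N i i / (n choose k) = real k / real n" if "i < n" for i
  proof -
    have "N i i = (n - 1) choose k'"
      unfolding N_def using that k card_subsets_containing[of "{..<n}" "{i, i}" k] k' by simp
    then show ?thesis using absorb ch n by (simp add: field_simps)
  qed
  have off: "N i j / (n choose k) = real k * (real k - 1) / (real n * (real n - 1))"
    if "i < n" "j < n" "i \<noteq> j" for i j
  proof (cases k')
    case 0
    \<comment> \<open>For \<open>k = 1\<close> no subset contains two distinct indices, and the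
      factor \<open>k - 1\<close> vanishes as well.\<close>
    have "{v. v \<subseteq> {..<n} \<and> card v = k \<and> {i, j} \<subseteq> v} = {}"
      using that k' 0 by (auto simp: card_Suc_eq)
    then have "N i j = 0" unfolding N_def by (metis card.empty)
    then show ?thesis using k' 0 by simp
  next
    case (Suc k'')
    have "N i j = n' choose k''"
      unfolding N_def using that k card_subsets_containing[of "{..<n}" "{i, j}" k] k' Suc n' by simp
    moreover have "real (n - 1) * real (n' choose k'') = real k' * real ((n - 1) choose k')"
      using Suc_times_binomial_eq[of n' k''] unfolding of_nat_mult[symmetric] of_nat_eq_iff n' Suc
      by (simp only: diff_Suc_1 mult.commute)
    ultimately have "real (n - 1) * N i j = real k' * real ((n - 1) choose k')" by simp
    then have "real n * real (n - 1) * N i j = real k' * (real k * real (n choose k))"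
      unfolding absorb[symmetric] by (simp only: ac_simps)
    moreover have "real k' = real k - 1" "real (n - 1) = real n - 1" using k' n by auto
    ultimately have "real n * (real n - 1) * N i j = real k * (real k - 1) * real (n choose k)"
      by (simp only: ac_simps)
    moreover have "real n * (real n - 1) \<noteq> 0" "real (n choose k) \<noteq> 0" using n ch by auto
    ultimately show ?thesis by (subst frac_eq_eq) (simp_all only: ac_simps not_False_eq_True)
  qed
  have "N i j / (n choose k) * a i j = real k * (real k - 1) / (real n * (real n - 1)) * a i j
      + (if i = j then real k * (real n - real k) / (real n * (real n - 1)) * a i j else 0)"
    if "i < n" "j < n" for i j
  proof (cases "i = j")
    case True
    have "real k / real n = real k * (real k - 1) / (real n * (real n - 1)) + real k * (real n - real k) / (real n * (real n - 1))"
    proof -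
      have "real k * (real k - 1) + real k * (real n - real k) = real k * (real n - 1)"
        by (simp add: algebra_simps)
      then show ?thesis using n by (simp flip: add_divide_distrib)
    qed
    then show ?thesis using diag[OF that(1)] True by (simp add: distrib_right)
  next
    case False
    then show ?thesis using off that by simp
  qed
  then have "(\<Sum>i<n. \<Sum>j<n. N i j / (n choose k) * a i j) =
     (\<Sum>i<n. \<Sum>j<n. real k * (real k - 1) / (real n * (real n - 1)) * a i j
      + (if i = j then real k * (real n - real k) / (real n * (real n - 1)) * a i j else 0))"
    by (intro sum.cong) auto
  also have "\<dots> = real k * (real k - 1) / (real n * (real n - 1)) * (\<Sum>i<n. \<Sum>j<n. a i j)
    + real k * (real n - real k) / (real n * (real n - 1)) * (\<Sum>i<n. a i i)"
    by (simp add: sum.distrib sum_distrib_left)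
  finally show ?thesis using 1 by simp
qed

subsection \<open>Power series in the interaction matrix\<close>

text \<open>This says that \<open>B\<close> has operator norm at most \<open>C\<close>. Tested on
  pairs of vectors, the condition is visibly invariant under transposition, and its left side is
  linear in \<open>B\<close>, so it passes to series term by term.\<close>

definition bilinear_bound :: "nat \<Rightarrow> (nat \<Rightarrow> nat \<Rightarrow> real) \<Rightarrow> real \<Rightarrow> bool" where
  "bilinear_bound n B C \<longleftrightarrow> 0 \<le> C \<and>
     (\<forall>x y. (\<Sum>i<n. \<Sum>j<n. y i * B i j * x j) \<le> C * L2_set x {..<n} * L2_set y {..<n})"

lemma bilinear_boundD:
  "bilinear_bound n B C \<Longrightarrow>
    (\<Sum>i<n. \<Sum>j<n. y i * B i j * x j) \<le> C * L2_set x {..<n} * L2_set y {..<n}"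
  by (simp add: bilinear_bound_def)

lemma sum_mult_le_L2_set: "(\<Sum>i\<in>A. y i * z i) \<le> L2_set y A * L2_set z A"
  by (rule order_trans[OF sum_mono L2_set_mult_ineq]) (simp flip: abs_mult)

lemma L2_set_power2: "(L2_set x A)\<^sup>2 = (\<Sum>i\<in>A. (x i)\<^sup>2)"
  by (simp add: L2_set_def sum_nonneg)

text \<open>Testing against the image vector itself produces the square of its norm; one factor of
  that norm then cancels.\<close>

lemma bilinear_bound_apply:
  assumes "bilinear_bound n B C"
  shows "L2_set (\<lambda>i. \<Sum>j<n. B i j * x j) {..<n} \<le> C * L2_set x {..<n}"
proof -
  let ?z = "\<lambda>i. \<Sum>j<n. B i j * x j"
  have "(L2_set ?z {..<n})\<^sup>2 = (\<Sum>i<n. \<Sum>j<n. ?z i * B i j * x j)"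
    unfolding L2_set_power2 by (simp add: power2_eq_square sum_distrib_left mult.assoc)
  also have "\<dots> \<le> C * L2_set x {..<n} * L2_set ?z {..<n}"
    by (rule bilinear_boundD[OF assms])
  finally have le: "L2_set ?z {..<n} * L2_set ?z {..<n} \<le> C * L2_set x {..<n} * L2_set ?z {..<n}"
    by (simp add: power2_eq_square)
  show ?thesis
  proof (cases "L2_set ?z {..<n} = 0")
    case True
    then show ?thesis using assms by (simp add: bilinear_bound_def)
  next
    case False
    then have "0 < L2_set ?z {..<n}" by (simp add: less_le)
    then show ?thesis using le by (simp add: mult_le_cancel_right)
  qed
qed

lemma bilinear_boundI:
  assumes "0 \<le> C" "\<And>x. L2_set (\<lambda>i. \<Sum>j<n. B i j * x j) {..<n} \<le> C * L2_set x {..<n}"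
  shows "bilinear_bound n B C"
  unfolding bilinear_bound_def
proof (intro conjI allI assms)
  fix x y :: "nat \<Rightarrow> real"
  have "(\<Sum>i<n. \<Sum>j<n. y i * B i j * x j) = (\<Sum>i<n. y i * (\<Sum>j<n. B i j * x j))"
    by (simp add: sum_distrib_left mult.assoc)
  also have "\<dots> \<le> L2_set y {..<n} * L2_set (\<lambda>i. \<Sum>j<n. B i j * x j) {..<n}"
    by (rule sum_mult_le_L2_set)
  also have "\<dots> \<le> L2_set y {..<n} * (C * L2_set x {..<n})"
    by (intro mult_left_mono assms) simp
  finally show "(\<Sum>i<n. \<Sum>j<n. y i * B i j * x j) \<le> C * L2_set x {..<n} * L2_set y {..<n}"
    by (simp add: ac_simps)
qed

lemma bilinear_bound_transpose:
  assumes "bilinear_bound n B C"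
  shows "bilinear_bound n (\<lambda>i j. B j i) C"
  unfolding bilinear_bound_def
proof (intro conjI allI)
  show "0 \<le> C" using assms by (simp add: bilinear_bound_def)
  fix x y :: "nat \<Rightarrow> real"
  have "(\<Sum>i<n. \<Sum>j<n. y i * B j i * x j) = (\<Sum>i<n. \<Sum>j<n. x i * B i j * y j)"
    by (subst sum.swap) (simp add: ac_simps)
  also have "\<dots> \<le> C * L2_set y {..<n} * L2_set x {..<n}" by (rule bilinear_boundD[OF assms])
  finally show "(\<Sum>i<n. \<Sum>j<n. y i * B j i * x j) \<le> C * L2_set x {..<n} * L2_set y {..<n}"
    by (simp add: ac_simps)
qed

lemma bilinear_bound_apply_transpose:
  assumes "bilinear_bound n B C"
  shows "L2_set (\<lambda>j. \<Sum>i<n. x i * B i j) {..<n} \<le> C * L2_set x {..<n}"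
  using bilinear_bound_apply[OF bilinear_bound_transpose[OF assms], of x] by (simp add: mult.commute)

lemma bilinear_bound_entry:
  assumes "bilinear_bound n B C" "i < n" "j < n"
  shows "B i j \<le> C"
  using bilinear_boundD[OF assms(1), of "\<lambda>l. if l = i then 1 else 0" "\<lambda>l. if l = j then 1 else 0"] assms(2,3)
  by (simp add: L2_set_def if_distrib[of "\<lambda>a. a * _"] if_distrib[of "\<lambda>a. _ * a"] if_distrib[of "\<lambda>a. a\<^sup>2"] cong: if_cong)

text \<open>For \<open>\<rho> \<noteq> 0\<close>, \<open>exp_tail 1 1 T \<rho>\<close> is
  \<open>(exp (T * \<rho>) - 1) / \<rho>\<close>; the series form covers \<open>\<rho> = 0\<close>
  too. It bounds what remains of a power series in \<open>\<xi>\<close> once factors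
  \<open>\<xi>\<close> have been split off.\<close>

definition exp_tail :: "nat \<Rightarrow> nat \<Rightarrow> real \<Rightarrow> real \<Rightarrow> real" where
  "exp_tail k l T \<rho> = (\<Sum>m. T ^ (m + k) / fact (m + l) * \<rho> ^ m)"

text \<open>\<open>pw m\<close> stands for the entries of the \<open>m\<close>-th power of
  \<open>X\<close>. Both recursions are present so that a factor can be split off on either side.
  Writing the restriction as a product with \<open>\<rho>\<close> includes the case
  \<open>\<rho> = 0\<close>.\<close>

locale interaction =
  fixes n :: nat and X :: "nat \<Rightarrow> nat \<Rightarrow> real" and pw :: "nat \<Rightarrow> nat \<Rightarrow> nat \<Rightarrow> real" and \<rho> T :: real
  assumes pw_0: "\<And>i j. i < n \<Longrightarrow> j < n \<Longrightarrow> pw 0 i j = (if i = j then 1 else 0)"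
    and pw_Suc: "\<And>m i j. i < n \<Longrightarrow> j < n \<Longrightarrow> pw (Suc m) i j = (\<Sum>l<n. X i l * pw m l j)"
    and pw_Suc': "\<And>m i j. i < n \<Longrightarrow> j < n \<Longrightarrow> pw (Suc m) i j = (\<Sum>l<n. pw m i l * X l j)"
    and X_nonneg: "\<And>i j. i < n \<Longrightarrow> j < n \<Longrightarrow> 0 \<le> X i j"
    and X_diag: "\<And>i. i < n \<Longrightarrow> X i i = 0"
    and X_bound: "bilinear_bound n X \<rho>"
    and T_pos: "0 < T" and T_le: "T * \<rho> \<le> ln 2 / 2"
begin

lemma rho_nonneg: "0 \<le> \<rho>" using X_bound by (simp add: bilinear_bound_def)

lemma pw_1: "i < n \<Longrightarrow> j < n \<Longrightarrow> pw 1 i j = X i j"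
  by (simp add: pw_Suc pw_0 if_distrib[of "\<lambda>a. _ * a"] cong: if_cong)

lemma pw_nonneg: "i < n \<Longrightarrow> j < n \<Longrightarrow> 0 \<le> pw m i j"
proof (induction m arbitrary: i)
  case 0 then show ?case by (simp add: pw_0)
next
  case (Suc m)
  then show ?case by (auto simp: pw_Suc X_nonneg intro!: sum_nonneg mult_nonneg_nonneg)
qed

lemma pw_bound: "bilinear_bound n (pw m) (\<rho> ^ m)"
proof (induction m)
  case 0
  have "L2_set (\<lambda>i. \<Sum>j<n. pw 0 i j * x j) {..<n} = L2_set x {..<n}" for x
    by (intro L2_set_cong) (auto simp: pw_0 if_distrib[of "\<lambda>a. a * _"] cong: if_cong)
  then show ?case by (intro bilinear_boundI) simp_all
next
  case (Suc m)
  show ?case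
  proof (rule bilinear_boundI)
    show "0 \<le> \<rho> ^ Suc m" using rho_nonneg by simp
    fix x :: "nat \<Rightarrow> real"
    have "L2_set (\<lambda>i. \<Sum>j<n. pw (Suc m) i j * x j) {..<n}
        = L2_set (\<lambda>i. \<Sum>l<n. X i l * (\<Sum>j<n. pw m l j * x j)) {..<n}"
    proof (intro L2_set_cong refl)
      fix i assume "i \<in> {..<n}"
      then have "(\<Sum>j<n. pw (Suc m) i j * x j) = (\<Sum>j<n. \<Sum>l<n. X i l * (pw m l j * x j))"
        by (intro sum.cong) (auto simp: pw_Suc sum_distrib_right mult.assoc)
      also have "\<dots> = (\<Sum>l<n. X i l * (\<Sum>j<n. pw m l j * x j))"
        by (subst sum.swap) (simp add: sum_distrib_left)
      finally show "(\<Sum>j<n. pw (Suc m) i j * x j) = (\<Sum>l<n. X i l * (\<Sum>j<n. pw m l j * x j))" .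
    qed
    also have "\<dots> \<le> \<rho> * L2_set (\<lambda>l. \<Sum>j<n. pw m l j * x j) {..<n}"
      by (rule bilinear_bound_apply[OF X_bound])
    also have "\<dots> \<le> \<rho> * (\<rho> ^ m * L2_set x {..<n})"
      by (intro mult_left_mono bilinear_bound_apply Suc rho_nonneg)
    finally show "L2_set (\<lambda>i. \<Sum>j<n. pw (Suc m) i j * x j) {..<n} \<le> \<rho> ^ Suc m * L2_set x {..<n}"
      by (simp add: mult.assoc)
  qed
qed

lemma pw_le: "i < n \<Longrightarrow> j < n \<Longrightarrow> pw m i j \<le> \<rho> ^ m"
  using bilinear_bound_entry[OF pw_bound] .

lemma summable_entries:
  assumes "\<And>m. 0 \<le> a m" "summable (\<lambda>m. a m * \<rho> ^ m)" "i < n" "j < n"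
  shows "summable (\<lambda>m. a m * pw m i j)"
  using assms pw_nonneg pw_le
  by (intro summable_comparison_test'[OF assms(2)]) (auto simp: abs_mult mult_left_mono)

text \<open>A power series with nonnegative coefficients has at \<open>X\<close> a norm at most its
  value at \<open>\<rho>\<close>. Testing with fixed vectors reduces this to comparing two scalar
  series.\<close>

lemma series_bound:
  assumes a: "\<And>m. 0 \<le> a m" and s: "summable (\<lambda>m. a m * \<rho> ^ m)"
  shows "bilinear_bound n (\<lambda>i j. \<Sum>m. a m * pw m i j) (\<Sum>m. a m * \<rho> ^ m)"
  unfolding bilinear_bound_def
proof (intro conjI allI)
  show "0 \<le> (\<Sum>m. a m * \<rho> ^ m)" using a s rho_nonneg by (intro suminf_nonneg) auto
  fix x y :: "nat \<Rightarrow> real"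
  have sum: "(\<lambda>m. a m * pw m i j) sums (\<Sum>m. a m * pw m i j)" if "i < n" "j < n" for i j
    using summable_entries[OF a s that] by (simp add: summable_sums)
  have "(\<lambda>m. \<Sum>i<n. \<Sum>j<n. y i * (a m * pw m i j) * x j)
      sums (\<Sum>i<n. \<Sum>j<n. y i * (\<Sum>m. a m * pw m i j) * x j)"
    by (intro sums_sum sums_mult sums_mult2 sum) auto
  moreover have "(\<Sum>i<n. \<Sum>j<n. y i * (a m * pw m i j) * x j) = a m * (\<Sum>i<n. \<Sum>j<n. y i * pw m i j * x j)" for m
    by (simp add: sum_distrib_left ac_simps)
  ultimately have 1: "(\<lambda>m. a m * (\<Sum>i<n. \<Sum>j<n. y i * pw m i j * x j))
      sums (\<Sum>i<n. \<Sum>j<n. y i * (\<Sum>m. a m * pw m i j) * x j)" by simp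
  have 2: "(\<lambda>m. a m * \<rho> ^ m * (L2_set x {..<n} * L2_set y {..<n}))
      sums ((\<Sum>m. a m * \<rho> ^ m) * (L2_set x {..<n} * L2_set y {..<n}))"
    using s by (intro sums_mult2) (simp add: summable_sums)
  have "a m * (\<Sum>i<n. \<Sum>j<n. y i * pw m i j * x j) \<le> a m * \<rho> ^ m * (L2_set x {..<n} * L2_set y {..<n})" for m
    using mult_left_mono[OF bilinear_boundD[OF pw_bound[of m], of y x] a[of m]] by (simp add: mult.assoc)
  from sums_le[OF this 1 2]
  show "(\<Sum>i<n. \<Sum>j<n. y i * (\<Sum>m. a m * pw m i j) * x j) \<le> (\<Sum>m. a m * \<rho> ^ m) * L2_set x {..<n} * L2_set y {..<n}"
    by (simp add: mult.assoc)
qed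

definition expm :: "real \<Rightarrow> nat \<Rightarrow> nat \<Rightarrow> real" where
  "expm s i j = (\<Sum>m. pw m i j / fact m * s ^ m)"

definition F :: "real \<Rightarrow> nat \<Rightarrow> nat \<Rightarrow> real" where
  "F s i j = expm s i j - (if i = j then 1 else 0)"

lemma summable_exp_coeff:
  "summable (\<lambda>m. s ^ m / fact m * \<rho> ^ m)" "(\<Sum>m. s ^ m / fact m * \<rho> ^ m) = exp (s * \<rho>)"
  using summable_exp[of "s * \<rho>"] by (simp_all add: exp_def power_mult_distrib field_simps)

lemma summable_expm:
  assumes "i < n" "j < n"
  shows "summable (\<lambda>m. pw m i j / fact m * s ^ m)"
proof (rule summable_comparison_test'[OF summable_exp_coeff(1)[of "\<bar>s\<bar>"]])
  fix m
  have "norm (pw m i j / fact m * s ^ m) = \<bar>s\<bar> ^ m / fact m * pw m i j"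
    using pw_nonneg[OF assms] by (simp add: abs_mult power_abs)
  also have "\<dots> \<le> \<bar>s\<bar> ^ m / fact m * \<rho> ^ m"
    using pw_le[OF assms] by (intro mult_left_mono) auto
  finally show "norm (pw m i j / fact m * s ^ m) \<le> \<bar>s\<bar> ^ m / fact m * \<rho> ^ m" .
qed

lemma expm_cont: "i < n \<Longrightarrow> j < n \<Longrightarrow> continuous_on A (\<lambda>s. expm s i j)"
  unfolding expm_def
  by (intro continuous_at_imp_continuous_on ballI isCont_powser_converges_everywhere summable_expm)

lemma F_cont [continuous_intros]: "i < n \<Longrightarrow> j < n \<Longrightarrow> continuous_on A (\<lambda>s. F s i j)"
  unfolding F_def by (intro continuous_intros expm_cont)

lemma F_series:
  assumes "i < n" "j < n"
  shows "(\<lambda>m. pw (Suc m) i j / fact (Suc m) * s ^ Suc m) sums F s i j"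
  using summable_sums[OF summable_expm[OF assms, of s]] assms
  unfolding F_def expm_def by (subst sums_Suc_iff) (simp add: pw_0)

lemma F_mono:
  assumes "i < n" "j < n" "0 \<le> s" "s \<le> t"
  shows "F s i j \<le> F t i j"
proof (rule sums_le[OF _ F_series F_series])
  fix m
  show "pw (Suc m) i j / fact (Suc m) * s ^ Suc m \<le> pw (Suc m) i j / fact (Suc m) * t ^ Suc m"
    using assms pw_nonneg[OF assms(1,2)] by (intro mult_left_mono power_mono divide_nonneg_nonneg) auto
qed (use assms in auto)

text \<open>All terms of the series are nonnegative, and the first one is
  \<open>s * X i j\<close>.\<close>

lemma F_ge:
  assumes "i < n" "j < n" "0 \<le> s"
  shows "s * X i j \<le> F s i j" "0 \<le> F s i j"
proof -
  have "(\<Sum>m\<in>{0}. pw (Suc m) i j / fact (Suc m) * s ^ Suc m) \<le> F s i j"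
    unfolding sums_unique[OF F_series[OF assms(1,2), of s]]
    using F_series[OF assms(1,2), of s] pw_nonneg[OF assms(1,2)] assms(3)
    by (intro sum_le_suminf) (auto simp: sums_iff simp del: power_Suc fact_Suc)
  then show 1: "s * X i j \<le> F s i j" using pw_1[OF assms(1,2)] by (simp add: mult.commute)
  have "0 \<le> s * X i j" using assms X_nonneg by simp
  then show "0 \<le> F s i j" using 1 by simp
qed

text \<open>Setting the zeroth exponential coefficient to 0 removes the identity from the matrix
  series and 1 from the scalar one.\<close>

lemma F_bound:
  assumes "0 \<le> s"
  shows "bilinear_bound n (F s) (exp (s * \<rho>) - 1)"
proof -
  define a where "a m = (if m = 0 then 0 else s ^ m / fact m)" for m
  have a: "0 \<le> a m" for m using assms by (simp add: a_def)
  have S: "(\<lambda>m. s ^ m / fact m * \<rho> ^ m) sums exp (s * \<rho>)"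
    using summable_exp_coeff[of s] summable_sums by metis
  have "(\<lambda>m. a (Suc m) * \<rho> ^ Suc m) sums (exp (s * \<rho>) - 1)"
    using S sums_Suc_iff[of "\<lambda>m. s ^ m / fact m * \<rho> ^ m" "exp (s * \<rho>) - 1"]
    by (simp add: a_def del: fact_Suc power_Suc)
  then have A: "(\<lambda>m. a m * \<rho> ^ m) sums (exp (s * \<rho>) - 1)"
    by (subst (asm) sums_Suc_iff) (simp add: a_def)
  have b: "bilinear_bound n (\<lambda>i j. \<Sum>m. a m * pw m i j) (exp (s * \<rho>) - 1)"
    using series_bound[OF a sums_summable[OF A]] sums_unique[OF A] by simp
  have "F s i j = (\<Sum>m. a m * pw m i j)" if "i < n" "j < n" for i j
  proof -
    have "(\<lambda>m. a (Suc m) * pw (Suc m) i j) sums F s i j"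
      using F_series[OF that, of s] by (simp add: a_def mult.commute del: fact_Suc power_Suc)
    then have "(\<lambda>m. a m * pw m i j) sums F s i j"
      by (subst (asm) sums_Suc_iff) (simp add: a_def)
    then show ?thesis by (simp add: sums_iff)
  qed
  then have "(\<Sum>i<n. \<Sum>j<n. y i * F s i j * x j) = (\<Sum>i<n. \<Sum>j<n. y i * (\<Sum>m. a m * pw m i j) * x j)" for x y
    by (intro sum.cong refl) simp
  then show ?thesis using b unfolding bilinear_bound_def by simp
qed

lemma summable_shifted:
  "summable (\<lambda>m. T ^ (m + k) / fact (m + l) * \<rho> ^ m)"
proof (rule summable_comparison_test'[OF summable_mult[OF summable_exp_coeff(1)[of T], of "T ^ k"]])
  fix m
  have "fact m \<le> (fact (m + l) :: real)" by (rule fact_mono) simp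
  then have "T ^ (m + k) / fact (m + l) * \<rho> ^ m \<le> T ^ (m + k) / fact m * \<rho> ^ m"
    using T_pos rho_nonneg by (intro mult_right_mono divide_left_mono) auto
  then show "norm (T ^ (m + k) / fact (m + l) * \<rho> ^ m) \<le> T ^ k * (T ^ m / fact m * \<rho> ^ m)"
    using T_pos rho_nonneg by (simp add: power_add ac_simps)
qed

text \<open>Splitting one factor off every power gives \<open>F T = X G\<close>, so row
  \<open>i\<close> of \<open>F T\<close> is row \<open>i\<close> of \<open>X\<close> multiplied by
  \<open>G\<close>. The bound holds for each row separately, as the sum of squared row sums in the
  theorem requires.\<close>

lemma F_row_bound:
  assumes "i < n"
  shows "(\<Sum>l<n. (F T i l)\<^sup>2) \<le> (exp_tail 1 1 T \<rho>)\<^sup>2 * (\<Sum>l<n. (X i l)\<^sup>2)"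
proof -
  define G where "G = (\<lambda>i j. \<Sum>m. T ^ Suc m / fact (Suc m) * pw m i j)"
  have sm: "summable (\<lambda>m. T ^ Suc m / fact (Suc m) * \<rho> ^ m)"
    using summable_shifted[of 1 1] by simp
  have nn: "0 \<le> T ^ Suc m / fact (Suc m)" for m using T_pos by simp
  have G: "bilinear_bound n G (exp_tail 1 1 T \<rho>)"
    using series_bound[OF nn sm] by (simp add: G_def exp_tail_def del: fact_Suc power_Suc)
  have "F T i j = (\<Sum>l<n. X i l * G l j)" if j: "j < n" for j
  proof -
    have "(\<lambda>m. \<Sum>l<n. X i l * (T ^ Suc m / fact (Suc m) * pw m l j)) sums (\<Sum>l<n. X i l * G l j)"
      unfolding G_def using summable_entries[OF nn sm _ j]
      by (intro sums_sum sums_mult summable_sums) auto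
    moreover have "(\<Sum>l<n. X i l * (T ^ Suc m / fact (Suc m) * pw m l j)) = pw (Suc m) i j / fact (Suc m) * T ^ Suc m" for m
      unfolding pw_Suc[OF assms j] sum_divide_distrib sum_distrib_right by (intro sum.cong) auto
    ultimately have "(\<lambda>m. pw (Suc m) i j / fact (Suc m) * T ^ Suc m) sums (\<Sum>l<n. X i l * G l j)"
      by (simp only:)
    then show ?thesis by (rule sums_unique2[OF F_series[OF assms j, of T]])
  qed
  then have "L2_set (F T i) {..<n} = L2_set (\<lambda>j. \<Sum>l<n. X i l * G l j) {..<n}"
    by (intro L2_set_cong) auto
  also have "\<dots> \<le> exp_tail 1 1 T \<rho> * L2_set (X i) {..<n}"
    by (rule bilinear_bound_apply_transpose[OF G])
  finally have "(L2_set (F T i) {..<n})\<^sup>2 \<le> (exp_tail 1 1 T \<rho> * L2_set (X i) {..<n})\<^sup>2"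
    by (intro power_mono) auto
  then show ?thesis by (simp add: L2_set_power2 power_mult_distrib)
qed

end

subsection \<open>The covariance matrix\<close>

context interaction
begin

definition cov :: "nat \<Rightarrow> nat \<Rightarrow> real" where
  "cov i j = integral {0..T} (\<lambda>s. \<Sum>l<n. expm s i l * expm s j l)"

definition dev :: "nat \<Rightarrow> nat \<Rightarrow> real" where
  "dev i j = cov i j / T - scaled_identity 1 i j"

text \<open>The entries of \<open>(I + F s) (I + F s)\<^sup>t - I\<close>; \<open>dev\<close> is
  their average over time.\<close>

definition N :: "real \<Rightarrow> nat \<Rightarrow> nat \<Rightarrow> real" where
  "N s i j = F s i j + F s j i + (\<Sum>l<n. F s i l * F s j l)"

definition diag_series :: "nat \<Rightarrow> real" where
  "diag_series i = (\<Sum>m. T ^ (m + 2) / fact (m + 3) * pw (m + 2) i i)"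

text \<open>Here the smallness of \<open>T\<close> is used. The first bound becomes the upper end 2
  of the spectrum; the second makes the norm of \<open>F s\<close> at most 1/2, whence the lower end
  1/4.\<close>

lemma exp_rho_le:
  assumes "0 \<le> s" "s \<le> T"
  shows "(exp (s * \<rho>))\<^sup>2 \<le> 2" "exp (s * \<rho>) \<le> 3 / 2"
proof -
  have "s * \<rho> \<le> T * \<rho>" using assms rho_nonneg by (intro mult_right_mono) auto
  then have "2 * (s * \<rho>) \<le> ln 2" using T_le by simp
  then have "exp (2 * (s * \<rho>)) \<le> exp (ln 2)" by (simp only: exp_le_cancel_iff)
  then show "(exp (s * \<rho>))\<^sup>2 \<le> 2" by (simp add: exp_double)
  then have "(exp (s * \<rho>))\<^sup>2 \<le> (3 / 2)\<^sup>2" by (simp add: power2_eq_square)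
  then show "exp (s * \<rho>) \<le> 3 / 2" by (rule power2_le_imp_le) simp
qed

lemma expm_eq: "expm s i j = scaled_identity 1 i j + F s i j"
  by (simp add: F_def scaled_identity_def)

lemma expm_prod:
  assumes "i < n" "j < n"
  shows "(\<Sum>l<n. expm s i l * expm s j l) = scaled_identity 1 i j + N s i j"
proof -
  have "(\<Sum>l<n. expm s i l * expm s j l) = (\<Sum>l<n. scaled_identity 1 i l * scaled_identity 1 j l)
    + (\<Sum>l<n. scaled_identity 1 i l * F s j l) + (\<Sum>l<n. F s i l * scaled_identity 1 j l) + (\<Sum>l<n. F s i l * F s j l)"
    by (simp add: expm_eq distrib_left distrib_right sum.distrib)
  then show ?thesis using assms
    by (simp add: N_def scaled_identity_def if_distrib[of "\<lambda>a. a * _"] if_distrib[of "\<lambda>a. _ * a"] cong: if_cong)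
qed

lemma N_cont: "i < n \<Longrightarrow> j < n \<Longrightarrow> continuous_on A (\<lambda>s. N s i j)"
  unfolding N_def by (intro continuous_intros) auto

lemma N_integrable: "i < n \<Longrightarrow> j < n \<Longrightarrow> (\<lambda>s. N s i j) integrable_on {0..T}"
  by (intro integrable_continuous_real N_cont)

lemma dev_eq:
  assumes "i < n" "j < n"
  shows "dev i j = integral {0..T} (\<lambda>s. N s i j) / T"
proof -
  have "cov i j = integral {0..T} (\<lambda>s. scaled_identity 1 i j + N s i j)"
    by (simp add: cov_def expm_prod assms)
  also have "\<dots> = T * scaled_identity 1 i j + integral {0..T} (\<lambda>s. N s i j)"
    using T_pos by (subst integral_add) (auto intro!: N_integrable assms)
  finally show ?thesis using T_pos by (simp add: dev_def field_simps)
qed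

lemma cov_symmetric: "symmetric_on {..<n} cov"
  by (auto simp: symmetric_on_def cov_def mult.commute)

lemma N_ge: "i < n \<Longrightarrow> j < n \<Longrightarrow> 0 \<le> s \<Longrightarrow> s * X i j \<le> N s i j"
proof -
  assume *: "i < n" "j < n" "0 \<le> s"
  then have "0 \<le> (\<Sum>l<n. F s i l * F s j l)" "0 \<le> F s j i" "s * X i j \<le> F s i j"
    using F_ge by (auto intro!: sum_nonneg)
  then show ?thesis unfolding N_def by linarith
qed

lemma N_mono:
  assumes "i < n" "j < n" "0 \<le> s" "s \<le> t"
  shows "N s i j \<le> N t i j"
  unfolding N_def using assms F_ge(2)
  by (intro add_mono F_mono sum_mono mult_mono) auto

lemma integral_ident: "integral {0..T} (\<lambda>s. s * a) = T\<^sup>2 / 2 * a"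
proof -
  have "((\<lambda>s. s * a) has_integral (T\<^sup>2 / 2 * a - 0\<^sup>2 / 2 * a)) {0..T}"
    using T_pos by (intro fundamental_theorem_of_calculus)
      (auto intro!: derivative_eq_intros simp flip: has_real_derivative_iff_has_vector_derivative)
  then have "((\<lambda>s. s * a) has_integral (T\<^sup>2 / 2 * a)) {0..T}" by simp
  then show ?thesis by (rule integral_unique)
qed

lemma integral_square: "integral {0..T} (\<lambda>s. s\<^sup>2 * a) = T ^ 3 / 3 * a"
proof -
  have "((\<lambda>s. s\<^sup>2 * a) has_integral (T ^ 3 / 3 * a - 0 ^ 3 / 3 * a)) {0..T}"
    using T_pos by (intro fundamental_theorem_of_calculus)
      (auto intro!: derivative_eq_intros simp flip: has_real_derivative_iff_has_vector_derivative)
  then have "((\<lambda>s. s\<^sup>2 * a) has_integral (T ^ 3 / 3 * a)) {0..T}" by simp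
  then show ?thesis by (rule integral_unique)
qed

text \<open>The part \<open>s * X i j\<close> of the integrand is kept; the average of
  \<open>s\<close> over \<open>{0..T}\<close> is \<open>T / 2\<close>.\<close>

lemma dev_lower:
  assumes "i < n" "j < n"
  shows "T / 2 * X i j \<le> dev i j"
proof -
  have "integral {0..T} (\<lambda>s. s * X i j) \<le> integral {0..T} (\<lambda>s. N s i j)"
    using N_ge[OF assms] by (intro integral_le N_integrable assms integrable_continuous_real continuous_intros) auto
  then have "T\<^sup>2 / 2 * X i j / T \<le> integral {0..T} (\<lambda>s. N s i j) / T"
    unfolding integral_ident using T_pos by (intro divide_right_mono) auto
  then show ?thesis using T_pos by (simp add: dev_eq[OF assms] power2_eq_square)
qed

lemma dev_nonneg: "i < n \<Longrightarrow> j < n \<Longrightarrow> 0 \<le> dev i j"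
  using dev_lower[of i j] X_nonneg[of i j] T_pos by (smt (verit) divide_pos_pos mult_nonneg_nonneg)

text \<open>The integrand increases in \<open>s\<close>, so its average is at most its final
  value.\<close>

lemma dev_upper:
  assumes "i < n" "j < n"
  shows "dev i j \<le> N T i j"
proof -
  have "integral {0..T} (\<lambda>s. N s i j) \<le> integral {0..T} (\<lambda>s. N T i j)"
    using N_mono[OF assms] by (intro integral_le N_integrable assms) auto
  also have "\<dots> = T * N T i j" using T_pos by simp
  finally show ?thesis using T_pos by (simp add: dev_eq[OF assms] field_simps)
qed

lemma dev_frobenius_lower:
  "(\<Sum>i<n. \<Sum>j<n. (X i j)\<^sup>2) \<le> 4 / T\<^sup>2 * (\<Sum>i<n. \<Sum>j<n. (dev i j)\<^sup>2)"
  unfolding sum_distrib_left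
proof (intro sum_mono)
  fix i j assume ij: "i \<in> {..<n}" "j \<in> {..<n}"
  then have "(T / 2 * X i j)\<^sup>2 \<le> (dev i j)\<^sup>2"
    using dev_lower[of i j] X_nonneg[of i j] T_pos by (intro power_mono) auto
  then show "(X i j)\<^sup>2 \<le> 4 / T\<^sup>2 * (dev i j)\<^sup>2"
    using T_pos by (simp add: field_simps power2_eq_square)
qed

text \<open>\<open>F T\<close> and its transpose have the same Frobenius norm. Their product has no
  larger one, since each of its rows is the image under \<open>F T\<close> of a row of
  \<open>F T\<close>, and \<open>F T\<close> is a contraction. The factor 9 is three such parts
  times the 3 from squaring a sum of three terms.\<close>

lemma dev_frobenius_upper:
  "(\<Sum>i<n. \<Sum>j<n. (dev i j)\<^sup>2) \<le> 9 * (exp_tail 1 1 T \<rho>)\<^sup>2 * (\<Sum>i<n. \<Sum>j<n. (X i j)\<^sup>2)"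
proof -
  define f where "f = (\<Sum>i<n. \<Sum>j<n. (F T i j)\<^sup>2)"
  have ff: "(\<Sum>i<n. \<Sum>j<n. (\<Sum>l<n. F T i l * F T j l)\<^sup>2) \<le> f"
    unfolding f_def
  proof (rule sum_mono)
    fix i
    have "L2_set (\<lambda>j. \<Sum>l<n. F T j l * F T i l) {..<n} \<le> (exp (T * \<rho>) - 1) * L2_set (F T i) {..<n}"
      using T_pos by (intro bilinear_bound_apply F_bound) auto
    also have "\<dots> \<le> 1 * L2_set (F T i) {..<n}"
      using exp_rho_le(2)[of T] T_pos by (intro mult_right_mono) auto
    finally have "(L2_set (\<lambda>j. \<Sum>l<n. F T j l * F T i l) {..<n})\<^sup>2 \<le> (L2_set (F T i) {..<n})\<^sup>2"
      by (intro power_mono) auto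
    then show "(\<Sum>j<n. (\<Sum>l<n. F T i l * F T j l)\<^sup>2) \<le> (\<Sum>j<n. (F T i j)\<^sup>2)"
      by (simp add: L2_set_power2 mult.commute)
  qed
  have ft: "(\<Sum>i<n. \<Sum>j<n. (F T j i)\<^sup>2) = f" unfolding f_def by (rule sum.swap)
  have "(\<Sum>i<n. \<Sum>j<n. (dev i j)\<^sup>2) \<le> (\<Sum>i<n. \<Sum>j<n. 3 * (F T i j)\<^sup>2 + 3 * (F T j i)\<^sup>2 + 3 * (\<Sum>l<n. F T i l * F T j l)\<^sup>2)"
  proof (intro sum_mono)
    fix i j assume ij: "i \<in> {..<n}" "j \<in> {..<n}"
    have "(dev i j)\<^sup>2 \<le> (N T i j)\<^sup>2"
      using ij dev_nonneg dev_upper by (intro power_mono) auto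
    also have "\<dots> \<le> 3 * (F T i j)\<^sup>2 + 3 * (F T j i)\<^sup>2 + 3 * (\<Sum>l<n. F T i l * F T j l)\<^sup>2"
    proof -
      have "(a + b + c)\<^sup>2 \<le> 3 * a\<^sup>2 + 3 * b\<^sup>2 + 3 * c\<^sup>2" for a b c :: real
        using zero_le_power2[of "a - b"] zero_le_power2[of "b - c"] zero_le_power2[of "a - c"]
        by (simp add: power2_eq_square algebra_simps)
      then show ?thesis unfolding N_def .
    qed
    finally show "(dev i j)\<^sup>2 \<le> 3 * (F T i j)\<^sup>2 + 3 * (F T j i)\<^sup>2 + 3 * (\<Sum>l<n. F T i l * F T j l)\<^sup>2" .
  qed
  also have "\<dots> = 3 * f + 3 * (\<Sum>i<n. \<Sum>j<n. (F T j i)\<^sup>2) + 3 * (\<Sum>i<n. \<Sum>j<n. (\<Sum>l<n. F T i l * F T j l)\<^sup>2)"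
    by (simp add: f_def sum.distrib sum_distrib_left)
  also have "\<dots> \<le> 9 * f" using ff ft by simp
  also have "\<dots> \<le> 9 * (\<Sum>i<n. (exp_tail 1 1 T \<rho>)\<^sup>2 * (\<Sum>j<n. (X i j)\<^sup>2))"
    unfolding f_def by (rule mult_left_mono[OF sum_mono[OF F_row_bound]]) auto
  finally show ?thesis by (simp add: sum_distrib_left mult.assoc)
qed

lemma cov_form: 
  "((\<lambda>s. \<Sum>l<n. (\<Sum>i<n. x i * expm s i l)\<^sup>2) has_integral quad_form {..<n} cov x) {0..T}"
proof -
  have "((\<lambda>s. \<Sum>l<n. expm s i l * expm s j l) has_integral cov i j) {0..T}" if "i < n" "j < n" for i j
    unfolding cov_def using that
    by (intro integrable_integral integrable_continuous_real continuous_intros expm_cont) auto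
  then have "((\<lambda>s. \<Sum>i<n. \<Sum>j<n. x i * (\<Sum>l<n. expm s i l * expm s j l) * x j) has_integral quad_form {..<n} cov x) {0..T}"
    unfolding quad_form_def
    by (intro has_integral_sum has_integral_mult_left has_integral_mult_right) auto
  moreover have "(\<Sum>i<n. \<Sum>j<n. x i * (\<Sum>l<n. expm s i l * expm s j l) * x j) = (\<Sum>l<n. (\<Sum>i<n. x i * expm s i l)\<^sup>2)" for s
  proof -
    have "(\<Sum>i<n. \<Sum>j<n. x i * (\<Sum>l<n. expm s i l * expm s j l) * x j)
      = (\<Sum>i<n. \<Sum>j<n. \<Sum>l<n. (x i * expm s i l) * (x j * expm s j l))"
      by (simp add: sum_distrib_left sum_distrib_right ac_simps)
    also have "\<dots> = (\<Sum>i<n. \<Sum>l<n. \<Sum>j<n. (x i * expm s i l) * (x j * expm s j l))"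
      by (rule sum.cong[OF refl], rule sum.swap)
    also have "\<dots> = (\<Sum>l<n. \<Sum>i<n. \<Sum>j<n. (x i * expm s i l) * (x j * expm s j l))"
      by (rule sum.swap)
    finally show ?thesis by (simp add: power2_eq_square sum_product)
  qed
  ultimately show ?thesis by simp
qed

text \<open>At each time the integrand is the squared norm of \<open>(I + F s)\<^sup>t x\<close>.
  The triangle inequality bounds this norm above by \<open>exp (s * \<rho>) * L\<close> and, used in
  reverse, below by \<open>L / 2\<close>.\<close>

lemma cov_form_bounds: "form_bounds {..<n} T cov"
  unfolding form_bounds_def
proof (intro allI)
  fix x :: "nat \<Rightarrow> real"
  define L where "L = L2_set x {..<n}"
  define z where "z s l = (\<Sum>i<n. x i * expm s i l)" for s l
  have L0: "0 \<le> L" by (simp add: L_def)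
  have z: "L\<^sup>2 / 4 \<le> (\<Sum>l<n. (z s l)\<^sup>2)" "(\<Sum>l<n. (z s l)\<^sup>2) \<le> 2 * L\<^sup>2" if s: "s \<in> {0..T}" for s
  proof -
    define y where "y l = (\<Sum>i<n. x i * F s i l)" for l
    have zy: "z s l = x l + y l" if "l < n" for l
      using that by (simp add: z_def y_def expm_eq scaled_identity_def distrib_left sum.distrib
          if_distrib[of "\<lambda>a. _ * a"] cong: if_cong)
    have Y: "L2_set y {..<n} \<le> (exp (s * \<rho>) - 1) * L"
      unfolding y_def L_def using s by (intro bilinear_bound_apply_transpose F_bound) auto
    have "L2_set (z s) {..<n} = L2_set (\<lambda>l. x l + y l) {..<n}"
      by (intro L2_set_cong) (auto simp: zy)
    also have "\<dots> \<le> L + L2_set y {..<n}"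
      unfolding L_def by (rule L2_set_triangle_ineq)
    finally have "L2_set (z s) {..<n} \<le> exp (s * \<rho>) * L" using Y by (simp add: left_diff_distrib)
    then have "(L2_set (z s) {..<n})\<^sup>2 \<le> (exp (s * \<rho>) * L)\<^sup>2" by (intro power_mono) auto
    also have "\<dots> \<le> 2 * L\<^sup>2"
      unfolding power_mult_distrib using exp_rho_le[of s] s by (intro mult_right_mono) auto
    finally show "(\<Sum>l<n. (z s l)\<^sup>2) \<le> 2 * L\<^sup>2" by (simp add: L2_set_power2)
    have "L = L2_set (\<lambda>l. z s l + (- y l)) {..<n}"
      unfolding L_def by (intro L2_set_cong) (auto simp: zy)
    also have "\<dots> \<le> L2_set (z s) {..<n} + L2_set (\<lambda>l. - y l) {..<n}"
      by (rule L2_set_triangle_ineq)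
    also have "L2_set (\<lambda>l. - y l) {..<n} = L2_set y {..<n}" by (simp add: L2_set_def)
    also have "L2_set y {..<n} \<le> 1 / 2 * L"
      using Y exp_rho_le(2)[of s] s mult_right_mono[OF _ L0, of "exp (s * \<rho>) - 1" "1 / 2"] by simp
    finally have "L / 2 \<le> L2_set (z s) {..<n}" by simp
    then have "(L / 2)\<^sup>2 \<le> (L2_set (z s) {..<n})\<^sup>2" using L0 by (intro power_mono) auto
    then show "L\<^sup>2 / 4 \<le> (\<Sum>l<n. (z s l)\<^sup>2)" by (simp add: L2_set_power2 power_divide)
  qed
  have "integral {0..T} (\<lambda>s. \<Sum>l<n. (z s l)\<^sup>2) = quad_form {..<n} cov x"
    "(\<lambda>s. \<Sum>l<n. (z s l)\<^sup>2) integrable_on {0..T}"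
    using cov_form[of x] unfolding z_def by (auto simp: integral_unique)
  moreover from this have "integral {0..T} (\<lambda>s. L\<^sup>2 / 4) \<le> integral {0..T} (\<lambda>s. \<Sum>l<n. (z s l)\<^sup>2)"
    "integral {0..T} (\<lambda>s. \<Sum>l<n. (z s l)\<^sup>2) \<le> integral {0..T} (\<lambda>s. 2 * L\<^sup>2)"
    using z by (intro integral_le; auto)+
  ultimately show "T / 4 * (\<Sum>i<n. (x i)\<^sup>2) \<le> quad_form {..<n} cov x \<and> quad_form {..<n} cov x \<le> 2 * T * (\<Sum>i<n. (x i)\<^sup>2)"
    using T_pos by (simp add: L_def L2_set_power2)
qed

text \<open>The power series \<open>a\<close> is an antiderivative. Of its first three terms only
  the linear one, \<open>T\<close>, survives, and it comes from the identity: the quadratic one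
  contains \<open>X i i = 0\<close>. Hence the series in \<open>D_term\<close> starts at
  \<open>m = 2\<close>.\<close>

lemma integral_F_diag:
  assumes i: "i < n"
  shows "integral {0..T} (\<lambda>s. F s i i) = T * diag_series i"
proof -
  define a where "a m = (if m = 0 then 0 else pw (m - 1) i i / fact m)" for m
  have sa: "summable (\<lambda>m. a m * y ^ m)" for y
  proof -
    have "summable (\<lambda>m. a (Suc m) * y ^ Suc m)"
    proof (rule summable_comparison_test'[OF summable_mult[OF summable_expm[OF i i, of "\<bar>y\<bar>"], of "\<bar>y\<bar>"]])
      fix m
      have "fact m \<le> (fact (Suc m) :: real)" by (rule fact_mono) simp
      then have "pw m i i / fact (Suc m) \<le> pw m i i / fact m"
        using pw_nonneg[OF i i] by (intro divide_left_mono) auto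
      then have "pw m i i / fact (Suc m) * \<bar>y\<bar> ^ Suc m \<le> pw m i i / fact m * \<bar>y\<bar> ^ Suc m"
        by (intro mult_right_mono) auto
      then show "norm (a (Suc m) * y ^ Suc m) \<le> \<bar>y\<bar> * (pw m i i / fact m * \<bar>y\<bar> ^ m)"
        using pw_nonneg[OF i i, of m] by (simp add: a_def abs_mult power_abs ac_simps del: fact_Suc)
    qed
    then show ?thesis by (subst (asm) summable_Suc_iff)
  qed
  have df: "diffs a = (\<lambda>m. pw m i i / fact m)"
    by (auto simp: diffs_def a_def)
  have "((\<lambda>s. expm s i i) has_integral ((\<Sum>m. a m * T ^ m) - (\<Sum>m. a m * 0 ^ m))) {0..T}"
  proof (intro fundamental_theorem_of_calculus)
    fix s
    have "DERIV (\<lambda>s. \<Sum>m. a m * s ^ m) s :> (\<Sum>m. diffs a m * s ^ m)"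
      by (rule termdiffs_strong_converges_everywhere[OF sa])
    then show "((\<lambda>s. \<Sum>m. a m * s ^ m) has_vector_derivative expm s i i) (at s within {0..T})"
      unfolding df expm_def
      by (auto simp: has_real_derivative_iff_has_vector_derivative intro: has_vector_derivative_at_within)
  qed (use T_pos in auto)
  then have "integral {0..T} (\<lambda>s. expm s i i) = (\<Sum>m. a m * T ^ m)"
    by (simp add: integral_unique powser_zero a_def)
  also have "\<dots> = (\<Sum>m. a (m + 3) * T ^ (m + 3)) + (\<Sum>m<3. a m * T ^ m)"
    by (rule suminf_split_initial_segment[OF sa])
  also have "(\<Sum>m<3. a m * T ^ m) = T"
    using pw_0[OF i i] pw_1[OF i i] X_diag[OF i] by (simp add: a_def eval_nat_numeral)
  also have "(\<Sum>m. a (m + 3) * T ^ (m + 3)) = T * diag_series i"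
  proof -
    have eq: "a (m + 3) * T ^ (m + 3) = T * (T ^ (m + 2) / fact (m + 3) * pw (m + 2) i i)" for m
      by (simp add: a_def power_add eval_nat_numeral del: fact_Suc)
    have "summable (\<lambda>m. a (m + 3) * T ^ (m + 3))" by (rule summable_ignore_initial_segment[OF sa])
    then have "summable (\<lambda>m. T ^ (m + 2) / fact (m + 3) * pw (m + 2) i i)"
      using T_pos unfolding eq by (subst (asm) summable_cmult_iff) auto
    then show ?thesis unfolding eq diag_series_def by (rule suminf_mult)
  qed
  finally have "integral {0..T} (\<lambda>s. expm s i i) = T * diag_series i + T" .
  moreover have "integral {0..T} (\<lambda>s. F s i i) = integral {0..T} (\<lambda>s. expm s i i) - T"
    unfolding F_def using T_pos
    by (subst integral_diff) (auto intro!: integrable_continuous_real expm_cont i)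
  ultimately show ?thesis by simp
qed

text \<open>On the diagonal the integrand is \<open>2 * F s i i\<close> plus a squared row norm of
  \<open>F s\<close>. The first part integrates exactly. The second lies between
  \<open>s\<^sup>2\<close> times the row sum of \<open>X\<close>, with average
  \<open>T\<^sup>2 / 3\<close>, and its value at \<open>T\<close>.\<close>

lemma dev_diag:
  assumes i: "i < n"
  shows "2 * diag_series i + T\<^sup>2 / 3 * (\<Sum>l<n. (X i l)\<^sup>2) \<le> dev i i"
    and "dev i i \<le> 2 * diag_series i + (exp_tail 1 1 T \<rho>)\<^sup>2 * (\<Sum>l<n. (X i l)\<^sup>2)"
proof -
  let ?r = "\<Sum>l<n. (X i l)\<^sup>2" and ?q = "\<lambda>s. \<Sum>l<n. (F s i l)\<^sup>2"
  have int: "(\<lambda>s. F s i i) integrable_on {0..T}" "?q integrable_on {0..T}"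
    using i by (auto intro!: integrable_continuous_real continuous_intros)
  have "integral {0..T} (\<lambda>s. N s i i) = integral {0..T} (\<lambda>s. 2 * F s i i + ?q s)"
    by (simp add: N_def power2_eq_square)
  also have "\<dots> = 2 * (T * diag_series i) + integral {0..T} ?q"
    using int by (subst integral_add) (auto simp: integral_F_diag[OF i])
  finally have d: "dev i i = 2 * diag_series i + integral {0..T} ?q / T"
    using T_pos by (simp add: dev_eq[OF i i] add_divide_distrib)
  have "integral {0..T} (\<lambda>s. s\<^sup>2 * ?r) \<le> integral {0..T} ?q"
  proof (intro integral_le int integrable_continuous_real continuous_intros)
    fix s assume s: "s \<in> {0..T}"
    show "s\<^sup>2 * ?r \<le> ?q s"
      unfolding sum_distrib_left power_mult_distrib[symmetric]
      using F_ge(1)[OF i] X_nonneg[OF i] s by (intro sum_mono power_mono) auto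
  qed
  then have "T ^ 3 / 3 * ?r / T \<le> integral {0..T} ?q / T"
    unfolding integral_square using T_pos by (intro divide_right_mono) auto
  then show "2 * diag_series i + T\<^sup>2 / 3 * ?r \<le> dev i i"
    unfolding d using T_pos by (simp add: power2_eq_square power3_eq_cube)
  have "integral {0..T} ?q \<le> integral {0..T} (\<lambda>s. (exp_tail 1 1 T \<rho>)\<^sup>2 * ?r)"
  proof (intro integral_le int)
    fix s assume s: "s \<in> {0..T}"
    have "?q s \<le> ?q T"
      using s F_mono[OF i] F_ge(2)[OF i] by (intro sum_mono power_mono) auto
    then show "?q s \<le> (exp_tail 1 1 T \<rho>)\<^sup>2 * ?r" using F_row_bound[OF i] by simp
  qed auto
  also have "\<dots> = T * ((exp_tail 1 1 T \<rho>)\<^sup>2 * ?r)" using T_pos by simp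
  finally show "dev i i \<le> 2 * diag_series i + (exp_tail 1 1 T \<rho>)\<^sup>2 * ?r"
    unfolding d using T_pos by (simp add: field_simps)
qed

lemma summable_diag_series:
  assumes "i < n"
  shows "summable (\<lambda>m. T ^ (m + 2) / fact (m + 3) * pw (m + 2) i i)"
proof (rule summable_comparison_test'[OF summable_mult[OF summable_shifted[of 2 3], of "\<rho>\<^sup>2"]])
  fix m
  have "T ^ (m + 2) / fact (m + 3) * pw (m + 2) i i \<le> T ^ (m + 2) / fact (m + 3) * \<rho> ^ (m + 2)"
    using T_pos by (intro mult_left_mono pw_le assms) simp
  then show "norm (T ^ (m + 2) / fact (m + 3) * pw (m + 2) i i) \<le> \<rho>\<^sup>2 * (T ^ (m + 2) / fact (m + 3) * \<rho> ^ m)"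
    using T_pos pw_nonneg[OF assms assms, of "m + 2"] by (simp add: power_add power2_eq_square ac_simps del: fact_Suc)
qed

text \<open>Only the leading term, the one with \<open>X\<close> squared, is kept; its coefficient
  is \<open>T\<^sup>2\<close> over 3 factorial.\<close>

lemma diag_series_lower:
  assumes i: "i < n"
  shows "T\<^sup>2 / 6 * (\<Sum>j<n. X i j * X j i) \<le> diag_series i" "0 \<le> diag_series i"
proof -
  have "(\<Sum>m\<in>{0}. T ^ (m + 2) / fact (m + 3) * pw (m + 2) i i) \<le> diag_series i"
    unfolding diag_series_def using T_pos pw_nonneg[OF i i]
    by (intro sum_le_suminf summable_diag_series i) auto
  moreover have "pw 2 i i = (\<Sum>j<n. X i j * X j i)"
    using pw_Suc[OF i i, of 1] pw_1 i by (simp add: numeral_2_eq_2)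
  ultimately show 1: "T\<^sup>2 / 6 * (\<Sum>j<n. X i j * X j i) \<le> diag_series i"
    by (simp add: eval_nat_numeral)
  have "0 \<le> T\<^sup>2 / 6 * (\<Sum>j<n. X i j * X j i)"
    using X_nonneg i by (intro mult_nonneg_nonneg sum_nonneg) auto
  then show "0 \<le> diag_series i" using 1 by simp
qed

text \<open>Splitting one factor off each side of the powers turns the series into the bilinear form
  of \<open>G\<close> at row \<open>i\<close> and column \<open>i\<close> of \<open>X\<close>. This
  is how column sums enter the bound.\<close>

lemma diag_series_upper:
  assumes i: "i < n"
  shows "(diag_series i)\<^sup>2 \<le> (exp_tail 2 3 T \<rho>)\<^sup>2 * ((\<Sum>j<n. (X i j)\<^sup>2)\<^sup>2 + (\<Sum>j<n. (X j i)\<^sup>2)\<^sup>2)"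
proof -
  define G where "G = (\<lambda>i j. \<Sum>m. T ^ (m + 2) / fact (m + 3) * pw m i j)"
  have nn: "0 \<le> T ^ (m + 2) / fact (m + 3)" for m using T_pos by simp
  note sm = summable_shifted[of 2 3]
  have G: "bilinear_bound n G (exp_tail 2 3 T \<rho>)"
    unfolding G_def exp_tail_def by (rule series_bound[OF nn sm])
  have "(\<lambda>m. \<Sum>a<n. \<Sum>b<n. X i a * (T ^ (m + 2) / fact (m + 3) * pw m a b) * X b i)
      sums (\<Sum>a<n. \<Sum>b<n. X i a * G a b * X b i)"
    unfolding G_def
    by (intro sums_sum sums_mult sums_mult2 summable_sums summable_entries nn sm) auto
  moreover have "(\<Sum>a<n. \<Sum>b<n. X i a * (T ^ (m + 2) / fact (m + 3) * pw m a b) * X b i)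
      = T ^ (m + 2) / fact (m + 3) * pw (m + 2) i i" for m
  proof -
    have "pw (m + 2) i i = (\<Sum>a<n. X i a * (\<Sum>b<n. pw m a b * X b i))"
      using pw_Suc[OF i i, of "Suc m"] pw_Suc' i by simp
    then show ?thesis by (simp add: sum_distrib_left ac_simps)
  qed
  ultimately have "diag_series i = (\<Sum>a<n. \<Sum>b<n. X i a * G a b * X b i)"
    unfolding diag_series_def by (simp add: sums_iff)
  also have "\<dots> \<le> exp_tail 2 3 T \<rho> * L2_set (\<lambda>b. X b i) {..<n} * L2_set (X i) {..<n}"
    by (rule bilinear_boundD[OF G])
  finally have "(diag_series i)\<^sup>2 \<le> (exp_tail 2 3 T \<rho> * L2_set (\<lambda>b. X b i) {..<n} * L2_set (X i) {..<n})\<^sup>2"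
    using diag_series_lower(2)[OF i] by (intro power_mono) auto
  also have "\<dots> = (exp_tail 2 3 T \<rho>)\<^sup>2 * ((\<Sum>j<n. (X j i)\<^sup>2) * (\<Sum>j<n. (X i j)\<^sup>2))"
    by (simp add: power_mult_distrib L2_set_power2)
  also have "\<dots> \<le> (exp_tail 2 3 T \<rho>)\<^sup>2 * ((\<Sum>j<n. (X i j)\<^sup>2)\<^sup>2 + (\<Sum>j<n. (X j i)\<^sup>2)\<^sup>2)"
    using abs_mult_le_sum_squares[of "\<Sum>j<n. (X i j)\<^sup>2" "\<Sum>j<n. (X j i)\<^sup>2"]
    by (intro mult_left_mono) (auto simp: power2_eq_square mult.commute)
  finally show ?thesis .
qed

text \<open>The lower estimate works because both contributions to \<open>dev i i\<close> are
  nonnegative, so each is dominated by it; \<open>9 / T ^ 4\<close> inverts the square of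
  \<open>T\<^sup>2 / 3\<close>. In the upper estimate,
  \<open>(a + b)\<^sup>2 \<le> 2 * a\<^sup>2 + 2 * b\<^sup>2\<close> produces the 8 and the
  2.\<close>

lemma dev_diag_sum:
  "(\<Sum>i<n. (dev i i)\<^sup>2) \<le> (8 + 2 * (exp_tail 1 1 T \<rho>) ^ 4) * ((\<Sum>i<n. (diag_series i)\<^sup>2) + (\<Sum>i<n. (\<Sum>j<n. (X i j)\<^sup>2)\<^sup>2))"
  "(\<Sum>i<n. (diag_series i)\<^sup>2) + (\<Sum>i<n. (\<Sum>j<n. (X i j)\<^sup>2)\<^sup>2) \<le> (1 + 9 / T ^ 4) * (\<Sum>i<n. (dev i i)\<^sup>2)"
proof -
  let ?r = "\<lambda>i. \<Sum>l<n. (X i l)\<^sup>2" and ?C = "exp_tail 1 1 T \<rho>"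
  show "(\<Sum>i<n. (dev i i)\<^sup>2) \<le> (8 + 2 * ?C ^ 4) * ((\<Sum>i<n. (diag_series i)\<^sup>2) + (\<Sum>i<n. (?r i)\<^sup>2))"
    unfolding sum.distrib[symmetric] sum_distrib_left
  proof (intro sum_mono)
    fix i assume "i \<in> {..<n}"
    then have i: "i < n" by simp
    have "(dev i i)\<^sup>2 \<le> (2 * diag_series i + ?C\<^sup>2 * ?r i)\<^sup>2"
      using dev_nonneg[OF i i] dev_diag(2)[OF i] by (intro power_mono) auto
    also have "\<dots> \<le> 2 * (2 * diag_series i)\<^sup>2 + 2 * (?C\<^sup>2 * ?r i)\<^sup>2"
      using zero_le_power2[of "2 * diag_series i - ?C\<^sup>2 * ?r i"]
      unfolding power2_sum power2_diff by simp
    also have "\<dots> = 8 * (diag_series i)\<^sup>2 + 2 * ?C ^ 4 * (?r i)\<^sup>2"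
      by (simp add: power_mult_distrib)
    also have "\<dots> \<le> (8 + 2 * ?C ^ 4) * ((diag_series i)\<^sup>2 + (?r i)\<^sup>2)"
      by (simp add: distrib_left distrib_right)
    finally show "(dev i i)\<^sup>2 \<le> (8 + 2 * ?C ^ 4) * ((diag_series i)\<^sup>2 + (?r i)\<^sup>2)" .
  qed
  show "(\<Sum>i<n. (diag_series i)\<^sup>2) + (\<Sum>i<n. (?r i)\<^sup>2) \<le> (1 + 9 / T ^ 4) * (\<Sum>i<n. (dev i i)\<^sup>2)"
    unfolding sum.distrib[symmetric] sum_distrib_left
  proof (intro sum_mono)
    fix i assume "i \<in> {..<n}"
    then have i: "i < n" by simp
    have "0 \<le> T\<^sup>2 / 3 * ?r i" by (intro mult_nonneg_nonneg sum_nonneg; simp)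
    note d = this diag_series_lower(2)[OF i]
    have "(diag_series i)\<^sup>2 \<le> (dev i i)\<^sup>2"
      using d dev_diag(1)[OF i] by (intro power_mono) linarith+
    moreover have "(T\<^sup>2 / 3 * ?r i)\<^sup>2 \<le> (dev i i)\<^sup>2"
      using d dev_diag(1)[OF i] by (intro power_mono) linarith+
    then have "(?r i)\<^sup>2 \<le> 9 / T ^ 4 * (dev i i)\<^sup>2"
      using T_pos by (simp add: power_mult_distrib power_divide field_simps)
    ultimately show "(diag_series i)\<^sup>2 + (?r i)\<^sup>2 \<le> (1 + 9 / T ^ 4) * (dev i i)\<^sup>2"
      by (simp add: distrib_right)
  qed
qed

end

subsection \<open>Interaction matrices\<close>

lemma euclidean_norm_mult_mat_vec:
  assumes "A \<in> carrier_mat n n"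
  shows "euclidean_norm (A *\<^sub>v Matrix.vec n x) = L2_set (\<lambda>i. \<Sum>j<n. A $$ (i, j) * x j) {..<n}"
  using assms by (auto simp: euclidean_norm_def L2_set_def scalar_prod_def atLeast0LessThan
      intro!: arg_cong[where f = sqrt] sum.cong)

lemma euclidean_norm_vec: "euclidean_norm (Matrix.vec n x) = L2_set x {..<n}"
  by (auto simp: euclidean_norm_def L2_set_def intro!: arg_cong[where f = sqrt] sum.cong)

text \<open>A real supremum says something only for a set bounded above; the sum of the row norms is
  a crude bound that suffices. Homogeneity then extends the estimate from the unit ball to all
  vectors.\<close>

lemma op_norm_bilinear_bound:
  assumes A: "A \<in> carrier_mat n n"
  shows "bilinear_bound n (\<lambda>i j. A $$ (i, j)) (op_norm A)"
proof -
  let ?U = "{x \<in> carrier_vec (dim_col A). euclidean_norm x \<le> 1}"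
  have U: "?U = {x \<in> carrier_vec n. euclidean_norm x \<le> 1}" using A by auto
  let ?b = "\<Sum>i<n. L2_set (\<lambda>j. A $$ (i, j)) {..<n}"
  have bdd: "bdd_above ((\<lambda>x. euclidean_norm (A *\<^sub>v x)) ` ?U)"
  proof (rule bdd_aboveI2)
    fix v assume "v \<in> ?U"
    then have "v \<in> carrier_vec n" "euclidean_norm v \<le> 1" unfolding U by auto
    moreover define x where "x = vec_index v"
    ultimately have v: "v = Matrix.vec n x" and x: "L2_set x {..<n} \<le> 1"
      by (auto simp: euclidean_norm_def L2_set_def)
    have "euclidean_norm (A *\<^sub>v v) \<le> (\<Sum>i<n. \<bar>\<Sum>j<n. A $$ (i, j) * x j\<bar>)"
      unfolding v euclidean_norm_mult_mat_vec[OF A] by (rule L2_set_le_sum_abs)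
    also have "\<dots> \<le> ?b"
    proof (rule sum_mono)
      fix i
      have "\<bar>\<Sum>j<n. A $$ (i, j) * x j\<bar> \<le> (\<Sum>j<n. \<bar>A $$ (i, j)\<bar> * \<bar>x j\<bar>)"
        unfolding abs_mult[symmetric] by (rule sum_abs)
      also have "\<dots> \<le> L2_set (\<lambda>j. A $$ (i, j)) {..<n} * L2_set x {..<n}"
        by (rule L2_set_mult_ineq)
      also have "\<dots> \<le> L2_set (\<lambda>j. A $$ (i, j)) {..<n} * 1"
        by (intro mult_left_mono x) simp
      finally show "\<bar>\<Sum>j<n. A $$ (i, j) * x j\<bar> \<le> L2_set (\<lambda>j. A $$ (i, j)) {..<n}" by simp
    qed
    finally show "euclidean_norm (A *\<^sub>v v) \<le> ?b" .
  qed
  have unit: "L2_set (\<lambda>i. \<Sum>j<n. A $$ (i, j) * x j) {..<n} \<le> op_norm A" if "L2_set x {..<n} \<le> 1" for x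
  proof -
    have "Matrix.vec n x \<in> ?U" using that A by (simp add: euclidean_norm_vec)
    from cSUP_upper[OF this bdd] show ?thesis
      by (simp add: op_norm_def euclidean_norm_mult_mat_vec[OF A])
  qed
  show ?thesis
  proof (rule bilinear_boundI)
    show nonneg: "0 \<le> op_norm A" using unit[of "\<lambda>_. 0"] by (simp add: L2_set_def)
    fix x :: "nat \<Rightarrow> real"
    show "L2_set (\<lambda>i. \<Sum>j<n. A $$ (i, j) * x j) {..<n} \<le> op_norm A * L2_set x {..<n}"
    proof (cases "L2_set x {..<n} = 0")
      case True
      then have "\<forall>j<n. x j = 0" by (simp add: L2_set_eq_0_iff)
      then show ?thesis by (simp add: L2_set_def True)
    next
      case False
      define L where "L = L2_set x {..<n}"
      have L: "0 < L" using False by (simp add: L_def less_le)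
      have scale: "L2_set (\<lambda>i. y i / L) {..<n} = L2_set y {..<n} / L" for y
        using L2_set_left_distrib[of "1 / L" y "{..<n}"] L by simp
      have "L2_set (\<lambda>i. \<Sum>j<n. A $$ (i, j) * (x j / L)) {..<n} \<le> op_norm A"
        by (rule unit) (use L in \<open>simp add: scale flip: L_def\<close>)
      then have "L2_set (\<lambda>i. \<Sum>j<n. A $$ (i, j) * x j) {..<n} / L \<le> op_norm A"
        by (simp add: scale flip: sum_divide_distrib)
      then show ?thesis using L by (simp add: field_simps flip: L_def)
    qed
  qed
qed

lemma pow_mat_Suc_left:
  fixes A :: "real mat"
  assumes A: "A \<in> carrier_mat n n"
  shows "A ^\<^sub>m Suc m = A * A ^\<^sub>m m"
proof (induction m)
  case 0
  then show ?case using A by simp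
next
  case (Suc m)
  have "A ^\<^sub>m Suc (Suc m) = (A * A ^\<^sub>m m) * A" using Suc by simp
  also have "\<dots> = A * (A ^\<^sub>m m * A)"
    using A by (intro assoc_mult_mat[of _ n n _ n _ n]) auto
  finally show ?case by simp
qed

lemma smult_pow_mat:
  fixes A :: "real mat"
  assumes A: "A \<in> carrier_mat n n"
  shows "(s \<cdot>\<^sub>m A) ^\<^sub>m m = s ^ m \<cdot>\<^sub>m A ^\<^sub>m m"
proof (induction m)
  case 0
  then show ?case using A by (intro eq_matI) auto
next
  case (Suc m)
  have P: "A ^\<^sub>m m \<in> carrier_mat n n" using A by simp
  have "(s \<cdot>\<^sub>m A) ^\<^sub>m Suc m = (s ^ m \<cdot>\<^sub>m A ^\<^sub>m m) * (s \<cdot>\<^sub>m A)" using Suc by simp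
  also have "\<dots> = s ^ Suc m \<cdot>\<^sub>m (A ^\<^sub>m m * A)"
    using A P by (intro eq_matI) (auto simp: mult_smult_distrib[of _ n n _ n] mult_smult_assoc_mat[of _ n n _ n])
  finally show ?case by simp
qed

lemma transpose_pow_mat:
  fixes A :: "real mat"
  assumes A: "A \<in> carrier_mat n n"
  shows "(transpose_mat A) ^\<^sub>m m = transpose_mat (A ^\<^sub>m m)"
proof (induction m)
  case 0
  then show ?case using A by simp
next
  case (Suc m)
  have "(transpose_mat A) ^\<^sub>m Suc m = transpose_mat (A ^\<^sub>m m) * transpose_mat A" using Suc by simp
  also have "\<dots> = transpose_mat (A * A ^\<^sub>m m)"
    using A by (intro transpose_mult[symmetric, of _ n n _ n]) auto
  finally show ?case using pow_mat_Suc_left[OF A] by simp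
qed

locale matrix_interaction =
  fixes n :: nat and \<xi> :: "real mat" and \<rho> T :: real
  assumes int_mat: "interaction_matrix n \<rho> \<xi>" and T_positive: "0 < T"
    and T_small: "\<rho> = 0 \<or> T \<le> ln 2 / (2 * \<rho>)"
begin

lemma xi_carrier: "\<xi> \<in> carrier_mat n n"
  using int_mat by (simp add: interaction_matrix_def)

sublocale interaction n "\<lambda>i j. \<xi> $$ (i, j)" "\<lambda>m i j. (\<xi> ^\<^sub>m m) $$ (i, j)" \<rho> T
proof
  have P: "\<xi> ^\<^sub>m m \<in> carrier_mat n n" for m using xi_carrier by simp
  show "(\<xi> ^\<^sub>m 0) $$ (i, j) = (if i = j then 1 else 0)" if "i < n" "j < n" for i j
    using that xi_carrier by simp
  show "(\<xi> ^\<^sub>m Suc m) $$ (i, j) = (\<Sum>l<n. \<xi> $$ (i, l) * (\<xi> ^\<^sub>m m) $$ (l, j))" if "i < n" "j < n" for m i j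
    unfolding pow_mat_Suc_left[OF xi_carrier]
    using that xi_carrier P[of m] by (simp add: scalar_prod_def atLeast0LessThan)
  show "(\<xi> ^\<^sub>m Suc m) $$ (i, j) = (\<Sum>l<n. (\<xi> ^\<^sub>m m) $$ (i, l) * \<xi> $$ (l, j))" if "i < n" "j < n" for m i j
    using that xi_carrier P[of m] by (simp add: scalar_prod_def atLeast0LessThan)
  show "0 \<le> \<xi> $$ (i, j)" if "i < n" "j < n" for i j
    using that int_mat by (simp add: interaction_matrix_def)
  show "\<xi> $$ (i, i) = 0" if "i < n" for i
    using that int_mat by (simp add: interaction_matrix_def)
  show b: "bilinear_bound n (\<lambda>i j. \<xi> $$ (i, j)) \<rho>"
    using op_norm_bilinear_bound[OF xi_carrier] int_mat by (simp add: interaction_matrix_def)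
  show "0 < T" by (rule T_positive)
  show "T * \<rho> \<le> ln 2 / 2"
  proof (cases "\<rho> = 0")
    case False
    then have "0 < \<rho>" using b by (simp add: bilinear_bound_def)
    then show ?thesis using T_small False by (simp add: field_simps)
  qed simp
qed

abbreviation "frob \<equiv> \<Sum>i<n. \<Sum>j<n. (\<xi> $$ (i, j))\<^sup>2"
abbreviation "row4 \<equiv> \<Sum>i<n. (\<Sum>j<n. (\<xi> $$ (i, j))\<^sup>2)\<^sup>2"
abbreviation "col4 \<equiv> \<Sum>i<n. (\<Sum>j<n. (\<xi> $$ (j, i))\<^sup>2)\<^sup>2"

lemma mat_exp_entry:
  assumes "i < n" "j < n"
  shows "mat_exp (s \<cdot>\<^sub>m \<xi>) $$ (i, j) = expm s i j"
    and "mat_exp (s \<cdot>\<^sub>m transpose_mat \<xi>) $$ (i, j) = expm s j i"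
proof -
  have P: "dim_row (\<xi> ^\<^sub>m m) = n" "dim_col (\<xi> ^\<^sub>m m) = n" for m
    using xi_carrier pow_carrier_mat[OF xi_carrier, of m] by auto
  have xT: "transpose_mat \<xi> \<in> carrier_mat n n" using xi_carrier by simp
  show "mat_exp (s \<cdot>\<^sub>m \<xi>) $$ (i, j) = expm s i j"
    using assms xi_carrier
    by (auto simp: mat_exp_def expm_def smult_pow_mat[OF xi_carrier] P mult.commute)
  show "mat_exp (s \<cdot>\<^sub>m transpose_mat \<xi>) $$ (i, j) = expm s j i"
    using assms xi_carrier
    by (auto simp: mat_exp_def expm_def smult_pow_mat[OF xT] transpose_pow_mat[OF xi_carrier] P mult.commute)
qed

lemma covariance_entry:
  assumes "i < n" "j < n"
  shows "covariance \<xi> T $$ (i, j) = cov i j"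
proof -
  have "(mat_exp (s \<cdot>\<^sub>m \<xi>) * mat_exp (s \<cdot>\<^sub>m transpose_mat \<xi>)) $$ (i, j) = (\<Sum>l<n. expm s i l * expm s j l)" for s
  proof -
    have d: "mat_exp (s \<cdot>\<^sub>m \<xi>) \<in> carrier_mat n n" "mat_exp (s \<cdot>\<^sub>m transpose_mat \<xi>) \<in> carrier_mat n n"
      using xi_carrier by (auto simp: mat_exp_def)
    have "(mat_exp (s \<cdot>\<^sub>m \<xi>) * mat_exp (s \<cdot>\<^sub>m transpose_mat \<xi>)) $$ (i, j) =
       (\<Sum>l<n. mat_exp (s \<cdot>\<^sub>m \<xi>) $$ (i, l) * mat_exp (s \<cdot>\<^sub>m transpose_mat \<xi>) $$ (l, j))"
      using d assms by (simp add: scalar_prod_def atLeast0LessThan)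
    then show ?thesis using assms by (simp add: mat_exp_entry)
  qed
  then show ?thesis using assms xi_carrier by (simp add: covariance_def cov_def)
qed

text \<open>\<open>D_term\<close> uses an unordered sum over an index set. Its terms are
  nonnegative, so the ordinary shifted series converges absolutely and both agree.\<close>

lemma D_term_eq: "D_term T \<xi> = (\<Sum>i<n. (diag_series i)\<^sup>2)"
proof -
  have "(\<Sum>\<^sub>\<infinity>m\<in>{2..}. T ^ m / fact (m + 1) * (\<xi> ^\<^sub>m m) $$ (i, i)) = diag_series i" if i: "i < n" for i
  proof -
    let ?f = "\<lambda>m. T ^ m / fact (m + 1) * (\<xi> ^\<^sub>m m) $$ (i, i)"
    have bij: "bij_betw (\<lambda>m. m + 2) UNIV {2::nat..}"
      by (rule bij_betwI[where g = "\<lambda>m. m - 2"]) auto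
    have f: "?f (m + 2) = T ^ (m + 2) / fact (m + 3) * (\<xi> ^\<^sub>m (m + 2)) $$ (i, i)" for m
      by (simp add: eval_nat_numeral)
    have nn: "norm (?f (m + 2)) = ?f (m + 2)" for m
      using pw_nonneg[OF i i, of "m + 2"] T_pos by (simp only: real_norm_def) (intro abs_of_nonneg; simp)
    have sm: "summable (\<lambda>m. ?f (m + 2))" unfolding f by (rule summable_diag_series[OF i])
    then have "(\<lambda>m. ?f (m + 2)) sums diag_series i"
      unfolding f diag_series_def by (rule summable_sums)
    moreover have "summable (\<lambda>m. norm (?f (m + 2)))" using sm by (simp only: nn)
    ultimately have "((\<lambda>m. ?f (m + 2)) has_sum diag_series i) UNIV"
      by (intro norm_summable_imp_has_sum)
    then have "(?f has_sum diag_series i) {2..}"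
      using has_sum_reindex_bij_betw[OF bij, of ?f] by simp
    then show ?thesis by (rule infsumI)
  qed
  then show ?thesis using xi_carrier by (simp add: D_term_def)
qed

section \<open>Assembly of the entropy estimates\<close>

lemma marginal_entropy_bounds:
  assumes v: "v \<subseteq> {..<n}"
  defines "H \<equiv> rel_entropy (marginal v (P_law \<xi> T)) (marginal v (Q_law n T))"
  shows "H \<le> 34 * (\<Sum>i\<in>v. \<Sum>j\<in>v. (dev i j)\<^sup>2) \<and> (\<Sum>i\<in>v. \<Sum>j\<in>v. (dev i j)\<^sup>2) \<le> 32 * H"
proof -
  have fin: "finite v" using v finite_subset by blast
  have C: "covariance \<xi> T \<in> carrier_mat n n" using xi_carrier by (simp add: covariance_def)
  obtain K c where 1: "gaussian_on v cov K c"
    "marginal v (P_law \<xi> T) = density (lebesgue_on_coords v) (gauss_density v K c)"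
    using marginal_gaussian_law[OF C covariance_entry cov_symmetric
        form_bounds_posdef[OF cov_form_bounds T_pos finite_lessThan] v]
    unfolding P_law_def by blast
  have I: "T \<cdot>\<^sub>m 1\<^sub>m n \<in> carrier_mat n n" by simp
  have I': "(T \<cdot>\<^sub>m 1\<^sub>m n) $$ (i, j) = scaled_identity T i j" if "i < n" "j < n" for i j
    using that by (simp add: scaled_identity_def)
  obtain K2 c2 where 2: "gaussian_on v (scaled_identity T) K2 c2"
    "marginal v (Q_law n T) = density (lebesgue_on_coords v) (gauss_density v K2 c2)"
    using marginal_gaussian_law[OF I I' scaled_identity_symmetric_posdef[OF T_pos finite_lessThan] v]
    unfolding Q_law_def by blast
  show ?thesis
    using entropy_frobenius_bounds[OF T_pos fin symmetric_on_subset[OF cov_symmetric v]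
        form_bounds_subset[OF cov_form_bounds finite_lessThan v] 1(1) 2(1)]
    unfolding H_def 1(2) 2(2) rel_entropy_scaled_identity[OF T_pos 1(1) 2(1)] dev_def .
qed

lemma avg_entropy_deviation_bounds:
  assumes n: "2 \<le> n" and k: "1 \<le> k" "k \<le> n"
  defines "R \<equiv> real k * (real k - 1) / (real n * (real n - 1)) * (\<Sum>i<n. \<Sum>j<n. (dev i j)\<^sup>2)
    + real k * (real n - real k) / (real n * (real n - 1)) * (\<Sum>i<n. (dev i i)\<^sup>2)"
  shows "avg_entropy \<xi> T k \<le> 34 * R" "R \<le> 32 * avg_entropy \<xi> T k"
proof -
  let ?V = "{v. v \<subseteq> {..<n} \<and> card v = k}"
  let ?H = "\<lambda>v. rel_entropy (marginal v (P_law \<xi> T)) (marginal v (Q_law n T))"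
  let ?F = "\<lambda>v. \<Sum>i\<in>v. \<Sum>j\<in>v. (dev i j)\<^sup>2"
  have R: "R = (\<Sum>v\<in>?V. ?F v) / (n choose k)"
    unfolding R_def by (rule average_over_subsets[symmetric, OF n k])
  have A: "avg_entropy \<xi> T k = (\<Sum>v\<in>?V. ?H v) / (n choose k)"
    using xi_carrier by (simp add: avg_entropy_def Let_def)
  have "(\<Sum>v\<in>?V. ?H v) \<le> (\<Sum>v\<in>?V. 34 * ?F v)"
    using marginal_entropy_bounds by (intro sum_mono) auto
  then show "avg_entropy \<xi> T k \<le> 34 * R"
    unfolding A R sum_distrib_left[symmetric] times_divide_eq_right by (intro divide_right_mono) auto
  have "(\<Sum>v\<in>?V. ?F v) \<le> (\<Sum>v\<in>?V. 32 * ?H v)"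
    using marginal_entropy_bounds by (intro sum_mono) auto
  then show "R \<le> 32 * avg_entropy \<xi> T k"
    unfolding A R sum_distrib_left[symmetric] times_divide_eq_right by (intro divide_right_mono) auto
qed

lemma avg_entropy_two_sided:
  assumes n: "2 \<le> n" and k: "k \<in> {1..n}"
  defines "w1 \<equiv> real k * (real k - 1) / (real n * (real n - 1))"
    and "w2 \<equiv> real k * (real n - real k) / (real n * (real n - 1))"
  defines "R \<equiv> w1 * frob + w2 * (D_term T \<xi> + row4)"
  shows "avg_entropy \<xi> T k \<le> 34 * (9 * (exp_tail 1 1 T \<rho>)\<^sup>2 + (8 + 2 * exp_tail 1 1 T \<rho> ^ 4)) * R"
    and "R \<le> (4 / T\<^sup>2 + (1 + 9 / T ^ 4)) * 32 * avg_entropy \<xi> T k"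
proof -
  let ?A = "9 * (exp_tail 1 1 T \<rho>)\<^sup>2" and ?B = "8 + 2 * exp_tail 1 1 T \<rho> ^ 4"
  let ?a = "4 / T\<^sup>2" and ?b = "1 + 9 / T ^ 4"
  let ?M = "\<Sum>i<n. \<Sum>j<n. (dev i j)\<^sup>2" and ?m = "\<Sum>i<n. (dev i i)\<^sup>2" and ?d = "D_term T \<xi> + row4"
  have w: "0 \<le> w1" "0 \<le> w2" using n k by (auto simp: w1_def w2_def)
  have pos: "0 \<le> frob" "0 \<le> ?d" "0 \<le> ?M" "0 \<le> ?m"
    by (auto simp: D_term_def intro!: sum_nonneg add_nonneg_nonneg)
  \<comment> \<open>Two estimates with different constants merge into one with the sum of the
    constants, as the cross terms are nonnegative.\<close>
  have mix: "w1 * x + w2 * y \<le> (p + q) * (w1 * x' + w2 * y')"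
    if "x \<le> p * x'" "y \<le> q * y'" "0 \<le> p" "0 \<le> q" "0 \<le> x'" "0 \<le> y'" for x y x' y' p q
  proof -
    have "w1 * x + w2 * y \<le> w1 * (p * x') + w2 * (q * y')"
      using that w by (intro add_mono mult_left_mono)
    also have "\<dots> \<le> w1 * (p * x') + w2 * (q * y') + (p * (w2 * y') + q * (w1 * x'))"
      using that w by simp
    also have "\<dots> = (p + q) * (w1 * x' + w2 * y')" by (simp add: algebra_simps)
    finally show ?thesis .
  qed
  have up: "w1 * ?M + w2 * ?m \<le> (?A + ?B) * R"
    unfolding R_def using dev_frobenius_upper dev_diag_sum(1) pos
    by (intro mix) (auto simp: D_term_eq)
  have low: "R \<le> (?a + ?b) * (w1 * ?M + w2 * ?m)"
    unfolding R_def using dev_frobenius_lower dev_diag_sum(2) pos T_pos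
    by (intro mix) (auto simp: D_term_eq)
  have "1 \<le> k" "k \<le> n" using k by auto
  note av = avg_entropy_deviation_bounds[OF n this, folded w1_def w2_def]
  show "avg_entropy \<xi> T k \<le> 34 * (?A + ?B) * R"
    unfolding mult.assoc[of 34] by (rule order_trans[OF av(1) mult_left_mono[OF up]]) simp
  have "(?a + ?b) * (w1 * ?M + w2 * ?m) \<le> (?a + ?b) * (32 * avg_entropy \<xi> T k)"
    using av(2) T_pos by (intro mult_left_mono) auto
  then show "R \<le> (?a + ?b) * 32 * avg_entropy \<xi> T k"
    unfolding mult.assoc[of _ 32] by (rule order_trans[OF low])
qed

lemma D_term_bounds:
  "(\<Sum>i<n. (\<Sum>j<n. \<xi> $$ (i, j) * \<xi> $$ (j, i))\<^sup>2) \<le> 36 / T ^ 4 * D_term T \<xi>"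
  "D_term T \<xi> \<le> (exp_tail 2 3 T \<rho>)\<^sup>2 * (row4 + col4)"
proof -
  show "(\<Sum>i<n. (\<Sum>j<n. \<xi> $$ (i, j) * \<xi> $$ (j, i))\<^sup>2) \<le> 36 / T ^ 4 * D_term T \<xi>"
    unfolding D_term_eq sum_distrib_left
  proof (rule sum_mono)
    fix i assume "i \<in> {..<n}"
    then have i: "i < n" by simp
    let ?s = "\<Sum>j<n. \<xi> $$ (i, j) * \<xi> $$ (j, i)"
    have "0 \<le> T\<^sup>2 / 6 * ?s" using X_nonneg i by (intro mult_nonneg_nonneg sum_nonneg) auto
    then have "(T\<^sup>2 / 6 * ?s)\<^sup>2 \<le> (diag_series i)\<^sup>2"
      using diag_series_lower(1)[OF i] by (intro power_mono)
    then have "T ^ 4 * ?s\<^sup>2 \<le> 36 * (diag_series i)\<^sup>2"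
      by (simp add: power_mult_distrib power_divide)
    then show "?s\<^sup>2 \<le> 36 / T ^ 4 * (diag_series i)\<^sup>2"
      using T_pos by (simp add: field_simps)
  qed
  show "D_term T \<xi> \<le> (exp_tail 2 3 T \<rho>)\<^sup>2 * (row4 + col4)"
    unfolding D_term_eq sum.distrib[symmetric] sum_distrib_left
    by (intro sum_mono diag_series_upper) auto
qed

lemma D_term_nonneg: "0 \<le> D_term T \<xi>"
  by (simp add: D_term_def sum_nonneg)

text \<open>Row sums and column sums coincide for a symmetric matrix, so the upper bound for
  \<open>D_term\<close> is a multiple of a term already present in the main estimate.\<close>

lemma D_term_symmetric:
  assumes "transpose_mat \<xi> = \<xi>"
  shows "D_term T \<xi> \<le> 2 * (exp_tail 2 3 T \<rho>)\<^sup>2 * row4"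
proof -
  have "\<xi> $$ (j, i) = \<xi> $$ (i, j)" if "i < n" "j < n" for i j
    using that xi_carrier assms by (metis carrier_matD index_transpose_mat(1))
  then have "col4 = row4" by simp
  then show ?thesis using D_term_bounds(2) by simp
qed

end

theorem theorem2p17:
  fixes T \<rho> :: real
  assumes "0 < T"
    and "\<rho> = 0 \<or> T \<le> ln 2 / (2 * \<rho>)"
  shows
    "(\<exists>c>0. \<exists>C>0. \<forall>n\<ge>2. \<forall>\<xi>. interaction_matrix n \<rho> \<xi> \<longrightarrow> (\<forall>k\<in>{1..n}.
        let R = real k * (real k - 1) / (real n * (real n - 1)) * (\<Sum>i<n. \<Sum>j<n. (\<xi> $$ (i, j))\<^sup>2)
              + real k * (real n - real k) / (real n * (real n - 1))
                * (D_term T \<xi> + (\<Sum>i<n. (\<Sum>j<n. (\<xi> $$ (i, j))\<^sup>2)\<^sup>2))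
        in avg_entropy \<xi> T k \<le> C * R \<and> R \<le> c * avg_entropy \<xi> T k))
   \<and> (\<exists>c>0. \<exists>C>0. \<forall>n\<ge>2. \<forall>\<xi>. interaction_matrix n \<rho> \<xi> \<longrightarrow>
        (\<Sum>i<n. (\<Sum>j<n. \<xi> $$ (i, j) * \<xi> $$ (j, i))\<^sup>2) \<le> c * D_term T \<xi>
        \<and> D_term T \<xi> \<le> C * ((\<Sum>i<n. (\<Sum>j<n. (\<xi> $$ (i, j))\<^sup>2)\<^sup>2)
                             + (\<Sum>i<n. (\<Sum>j<n. (\<xi> $$ (j, i))\<^sup>2)\<^sup>2)))
   \<and> (\<exists>c>0. \<exists>C>0. \<forall>n\<ge>2. \<forall>\<xi>. interaction_matrix n \<rho> \<xi> \<and> transpose_mat \<xi> = \<xi> \<longrightarrow> (\<forall>k\<in>{1..n}.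
        let R = real k * (real k - 1) / (real n * (real n - 1)) * (\<Sum>i<n. \<Sum>j<n. (\<xi> $$ (i, j))\<^sup>2)
              + real k * (real n - real k) / (real n * (real n - 1))
                * (\<Sum>i<n. (\<Sum>j<n. (\<xi> $$ (i, j))\<^sup>2)\<^sup>2)
        in avg_entropy \<xi> T k \<le> C * R \<and> R \<le> c * avg_entropy \<xi> T k))"
proof -
  \<comment> \<open>The witnesses are expressions in \<open>T\<close> and \<open>\<rho>\<close>
    only, fixed before \<open>n\<close> and \<open>\<xi>\<close>.\<close>
  define Cu where "Cu = 34 * (9 * (exp_tail 1 1 T \<rho>)\<^sup>2 + (8 + 2 * exp_tail 1 1 T \<rho> ^ 4))"
  define cl where "cl = (4 / T\<^sup>2 + (1 + 9 / T ^ 4)) * 32"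
  define Cd where "Cd = 2 * (exp_tail 2 3 T \<rho>)\<^sup>2"
  have Cu: "0 < Cu"
    unfolding Cu_def by (intro mult_pos_pos add_nonneg_pos add_pos_nonneg) auto
  have cl: "0 < cl"
    unfolding cl_def using assms(1) by (intro mult_pos_pos add_pos_pos) auto
  have Cd: "0 \<le> Cd" by (simp add: Cd_def)
  have loc: "matrix_interaction n \<xi> \<rho> T" if "interaction_matrix n \<rho> \<xi>" for n \<xi>
    using that assms by unfold_locales
  show ?thesis
  proof (intro conjI)
    show "\<exists>c>0. \<exists>C>0. \<forall>n\<ge>2. \<forall>\<xi>. interaction_matrix n \<rho> \<xi> \<longrightarrow> (\<forall>k\<in>{1..n}.
        let R = real k * (real k - 1) / (real n * (real n - 1)) * (\<Sum>i<n. \<Sum>j<n. (\<xi> $$ (i, j))\<^sup>2)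
              + real k * (real n - real k) / (real n * (real n - 1))
                * (D_term T \<xi> + (\<Sum>i<n. (\<Sum>j<n. (\<xi> $$ (i, j))\<^sup>2)\<^sup>2))
        in avg_entropy \<xi> T k \<le> C * R \<and> R \<le> c * avg_entropy \<xi> T k)"
      unfolding Let_def
      by (rule exI[of _ cl], rule conjI[OF cl], rule exI[of _ Cu], rule conjI[OF Cu])
        (use matrix_interaction.avg_entropy_two_sided[OF loc] in \<open>auto simp only: Cu_def cl_def\<close>)
  next
    \<comment> \<open>Adding 1 makes the constant positive without having to show that
      \<open>exp_tail\<close> does not vanish.\<close>
    have c: "0 < 36 / T ^ 4" "0 < Cd + 1" using assms(1) Cd by auto
    show "\<exists>c>0. \<exists>C>0. \<forall>n\<ge>2. \<forall>\<xi>. interaction_matrix n \<rho> \<xi> \<longrightarrow>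
        (\<Sum>i<n. (\<Sum>j<n. \<xi> $$ (i, j) * \<xi> $$ (j, i))\<^sup>2) \<le> c * D_term T \<xi>
        \<and> D_term T \<xi> \<le> C * ((\<Sum>i<n. (\<Sum>j<n. (\<xi> $$ (i, j))\<^sup>2)\<^sup>2)
                             + (\<Sum>i<n. (\<Sum>j<n. (\<xi> $$ (j, i))\<^sup>2)\<^sup>2))"
    proof (rule exI[of _ "36 / T ^ 4"], rule conjI[OF c(1)], rule exI[of _ "Cd + 1"], rule conjI[OF c(2)],
        intro allI impI conjI)
      fix n \<xi> assume \<xi>: "interaction_matrix n \<rho> \<xi>"
      interpret matrix_interaction n \<xi> \<rho> T by (rule loc[OF \<xi>])
      show "(\<Sum>i<n. (\<Sum>j<n. \<xi> $$ (i, j) * \<xi> $$ (j, i))\<^sup>2) \<le> 36 / T ^ 4 * D_term T \<xi>"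
        by (rule D_term_bounds(1))
      have "(exp_tail 2 3 T \<rho>)\<^sup>2 * (row4 + col4) \<le> (Cd + 1) * (row4 + col4)"
        unfolding Cd_def by (intro mult_right_mono add_nonneg_nonneg sum_nonneg) auto
      then show "D_term T \<xi> \<le> (Cd + 1) * (row4 + col4)" using D_term_bounds(2) by linarith
    qed
  next
    \<comment> \<open>Upwards, \<open>D_term\<close> is absorbed into \<open>row4\<close> at the
      price of a factor \<open>1 + Cd\<close>; downwards it is dropped, being nonnegative, and
      \<open>cl\<close> remains unchanged.\<close>
    have c: "0 < Cu * (1 + Cd)" using Cu Cd by auto
    show "\<exists>c>0. \<exists>C>0. \<forall>n\<ge>2. \<forall>\<xi>. interaction_matrix n \<rho> \<xi> \<and> transpose_mat \<xi> = \<xi> \<longrightarrow> (\<forall>k\<in>{1..n}.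
        let R = real k * (real k - 1) / (real n * (real n - 1)) * (\<Sum>i<n. \<Sum>j<n. (\<xi> $$ (i, j))\<^sup>2)
              + real k * (real n - real k) / (real n * (real n - 1))
                * (\<Sum>i<n. (\<Sum>j<n. (\<xi> $$ (i, j))\<^sup>2)\<^sup>2)
        in avg_entropy \<xi> T k \<le> C * R \<and> R \<le> c * avg_entropy \<xi> T k)"
      unfolding Let_def
    proof (rule exI[of _ cl], rule conjI[OF cl], rule exI[of _ "Cu * (1 + Cd)"], rule conjI[OF c],
        intro allI impI ballI, elim conjE)
      fix n \<xi> k assume n: "2 \<le> n" and \<xi>: "interaction_matrix n \<rho> \<xi>" "transpose_mat \<xi> = \<xi>" and k: "k \<in> {1..n}"
      interpret matrix_interaction n \<xi> \<rho> T by (rule loc[OF \<xi>(1)])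
      define w1 where "w1 = real k * (real k - 1) / (real n * (real n - 1))"
      define w2 where "w2 = real k * (real n - real k) / (real n * (real n - 1))"
      have w: "0 \<le> w1" "0 \<le> w2" using n k by (auto simp: w1_def w2_def)
      note two = avg_entropy_two_sided[OF n k, folded w1_def w2_def Cu_def cl_def]
      have pos: "0 \<le> frob" "0 \<le> row4" by (auto intro!: sum_nonneg)
      have "w1 * frob + w2 * (D_term T \<xi> + row4) \<le> w1 * frob + w2 * (Cd * row4 + row4)"
        using D_term_symmetric[OF \<xi>(2)] w unfolding Cd_def by (intro add_left_mono mult_left_mono) auto
      also have "\<dots> \<le> w1 * frob + w2 * (Cd * row4 + row4) + Cd * (w1 * frob)"
        using w Cd pos by simp
      also have "\<dots> = (1 + Cd) * (w1 * frob + w2 * row4)" by (simp add: algebra_simps)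
      finally have "Cu * (w1 * frob + w2 * (D_term T \<xi> + row4)) \<le> Cu * ((1 + Cd) * (w1 * frob + w2 * row4))"
        using Cu by (intro mult_left_mono) auto
      then have 1: "avg_entropy \<xi> T k \<le> Cu * (1 + Cd) * (w1 * frob + w2 * row4)"
        using two(1) by (simp add: mult.assoc)
      have "w1 * frob + w2 * row4 \<le> w1 * frob + w2 * (D_term T \<xi> + row4)"
        using w D_term_nonneg by (intro add_left_mono mult_left_mono) auto
      then have 2: "w1 * frob + w2 * row4 \<le> cl * avg_entropy \<xi> T k"
        using two(2) by linarith
      show "avg_entropy \<xi> T k \<le> Cu * (1 + Cd) *
           (real k * (real k - 1) / (real n * (real n - 1)) * frob + real k * (real n - real k) / (real n * (real n - 1)) * row4) \<and>
         real k * (real k - 1) / (real n * (real n - 1)) * frob + real k * (real n - real k) / (real n * (real n - 1)) * row4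
          \<le> cl * avg_entropy \<xi> T k"
        using 1 2 unfolding w1_def w2_def by blast
    qed
  qed
qed

end
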